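(* There is an absolute constant $C>0$ such that the following holds. Consider the problem $\min_{x\in\mathbb{R}^d}F(x)$, $F=f+\psi$, where $F$ is bounded below by $F^\star\in\mathbb{R}$, $f$ is $L$-smooth, and the stochastic gradient oracle of $f$ is unbiased with variance at most $\sigma^2$. Let $\varepsilon>0$ be a target error, let $F_0:=F(x_0)-F^\star$ and $\Phi_0:=F_0+\frac{3}{8L}\mathbb{E}\|m_0-\nabla f(x_0)\|^2$, and assume $\Phi_0>0$. Then there is a number of iterations $$K=\mathcal{O}\Bigl(\frac{L\Phi_0\sigma^2}{\varepsilon^2}+\frac{L\Phi_0}{\varepsilon}\Bigr),\qquad\text{i.e. an integer } 1\le K\le\Bigl\lceil C\Bigl(\frac{L\Phi_0\sigma^2}{\varepsilon^2}+\frac{L\Phi_0}{\varepsilon}\Bigr)\Bigr\rceil,$$ such that if the proximal gradient method with Polyak momentum and exact proximal steps is run for $K$ iterations with constant coefficients $M_k=M:=4L+\frac{3^{3/2}}{2}\sqrt{\frac{KL\sigma^2}{\Phi_0}}$ and $\gamma_k=\frac{3L}{M-L}$ for $0\le k\le K-1$, then for $x_t$ chosen uniformly at random from $\{x_1,\dots,x_K\}$ (with $t$ independent of everything else) we have $\mathbb{E}\|\nabla F(x_t)\|^2\le\varepsilon$. Moreover: (i) If $\psi\equiv0$, then $m_{-1}$ can be initialized in such a way that $K=\mathcal{O}\bigl(\frac{LF_0\sigma^2}{\varepsilon^2}+\frac{LF_0}{\varepsilon}\bigr)$. (ii) Otherwise, $m_{-1}$ can be initialized in such a way that $K=\mathcal{O}\bigl(\frac{LF_0\sigma^2}{\varepsilon^2}+\frac{\sigma^4}{\varepsilon^2}+\frac{LF_0}{\varepsilon}+\frac{\sigma^2}{\varepsilon}\bigr)$.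 (iii) If, in addition, an initial mini-batch of size $\lceil\frac{\sigma^2}{LF_0}\rceil$ is allowed (with $F_0>0$), then $m_{-1}$ can be initialized in such a way that $K=\mathcal{O}\bigl(\frac{LF_0\sigma^2}{\varepsilon^2}+\frac{LF_0}{\varepsilon}\bigr)$. All $\mathcal{O}(\cdot)$ hide only absolute constants (with the bound rounded up to an integer).
   Context: Setting. $d\ge1$, $L>0$, $\sigma\ge0$; $\|\cdot\|$ is the Euclidean norm. $f:\mathbb{R}^d\to\mathbb{R}$ and $\psi:\mathbb{R}^d\to\mathbb{R}$ are differentiable (convexity is not assumed), and $F:=f+\psi$. "$F$ is bounded below by $F^\star$" means $F^\star\le F(x)$ for all $x$. "$f$ is $L$-smooth" means $\|\nabla f(x)-\nabla f(y)\|\le L\|x-y\|$ for all $x,y$. "The oracle is unbiased with variance at most $\sigma^2$" means that a random vector $\nabla f(x,\xi)$ is available with $\mathbb{E}[\nabla f(x,\xi)]=\nabla f(x)$ and $\mathbb{E}\|\nabla f(x,\xi)-\nabla f(x)\|^2\le\sigma^2$ for every $x$. Proximal gradient method with Polyak momentum. Inputs: a deterministic $x_0\in\mathbb{R}^d$, a (possibly random) vector $m_{-1}$, deterministic $M_k>0$ ($k\ge0$) and $\gamma_k$ ($k\ge-1$; $\gamma_{-1}\in(0,1)$ is user-chosen). For $k=0,1,2,\dots$: compute $g_k=\nabla f(x_k,\xi_k)$ with a fresh sample $\xi_k$ (for each $k\ge0$, $\xi_{k+1}$ is independent of $x_0,\dots,x_{k+1},m_{-1},\dots,m_k$); set $m_k=(1-\gamma_{k-1})m_{k-1}+\gamma_{k-1}g_k$;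 with $\Omega_k(x):=\langle m_k,x\rangle+\psi(x)+\frac{M_k}{2}\|x-x_k\|^2$, compute a (random) point $x_{k+1}$ with $\Omega_k(x_{k+1})\le\Omega_k(x_k)$. "Exact proximal steps" means that moreover $\nabla\Omega_k(x_{k+1})=0$ for every $k$. Initialization: the vector $m_{-1}$ may be chosen as a function of $g_0$. "An initial mini-batch of size $b_0$ is allowed" means that at iteration $0$ one may use $g_0=\frac1{b_0}\sum_{i=1}^{b_0}\nabla f(x_0,\xi_{0,i})$ with $b_0$ independent samples instead of a single-sample gradient. *)

theory Defs
  imports "HOL-Probability.Probability"
begin

definition gradient :: "('a::real_inner \<Rightarrow> real) \<Rightarrow> 'a \<Rightarrow> 'a" where
  "gradient f x = (THE D. GDERIV f x :> D)"

lemma gradient_eqI: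
  fixes f :: "'a::real_inner \<Rightarrow> real"
  assumes "GDERIV f x :> D"
  shows "gradient f x = D"
  unfolding gradient_def
proof (rule the_equality[where P = "\<lambda>D. GDERIV f x :> D", OF assms])
  fix D' assume "GDERIV f x :> D'"
  with assms have "(\<lambda>h. inner h D') = (\<lambda>h. inner h D)"
    unfolding gderiv_def by (rule has_derivative_unique[rotated])
  then have "inner (D' - D) D' = inner (D' - D) D" by metis
  then have "inner (D' - D) (D' - D) = 0" by (simp add: inner_diff_right)
  then show "D' = D" by simp
qed

lemma GDERIV_gradient:
  fixes f :: "'a::euclidean_space \<Rightarrow> real"
  assumes "f differentiable (at x)"
  shows "GDERIV f x :> gradient f x"
proof -
  obtain f' where f': "(f has_derivative f') (at x)"
    using assms unfolding differentiable_def by blast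
  then have lin: "linear f'" by (rule has_derivative_linear)
  define D where "D = (\<Sum>b\<in>Basis. f' b *\<^sub>R b)"
  have "f' h = inner h D" for h
  proof -
    have "f' h = f' (\<Sum>b\<in>Basis. inner h b *\<^sub>R b)" by (simp add: euclidean_representation)
    also have "\<dots> = (\<Sum>b\<in>Basis. inner h b * f' b)"
      by (simp add: linear_sum[OF lin] linear_cmul[OF lin])
    also have "\<dots> = inner h D" by (simp add: D_def inner_sum_right mult.commute)
    finally show ?thesis .
  qed
  then have "f' = (\<lambda>h. inner h D)" by auto
  with f' have "GDERIV f x :> D" by (simp add: gderiv_def)
  with gradient_eqI[OF this] show ?thesis by simp
qed

definition L_smooth :: "real \<Rightarrow> ('a::real_inner \<Rightarrow> real) \<Rightarrow> bool" where
  "L_smooth L f \<longleftrightarrow> (\<forall>x y. norm (gradient f x - gradient f y) \<le> L * norm (x - y))"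

text \<open>
  The sample \<open>\<xi>\<close> has law \<open>D\<close>, and \<open>G x s\<close> is the stochastic gradient at \<open>x\<close> for the sample value
  \<open>s\<close>.  Joint measurability makes \<open>G (x\<^sub>k) (\<xi>\<^sub>k)\<close> a random vector for random \<open>x\<^sub>k\<close>.  The second
  moment is a nonnegative integral, since a Bochner integral would be 0 for infinite variance.
\<close>
definition unbiased_oracle ::
    "'s measure \<Rightarrow> ('a::euclidean_space \<Rightarrow> 's \<Rightarrow> 'a) \<Rightarrow> ('a \<Rightarrow> real) \<Rightarrow> real \<Rightarrow> bool" where
  "unbiased_oracle D G f \<sigma> \<longleftrightarrow>
     prob_space D \<and>
     (\<lambda>(x, s). G x s) \<in> borel_measurable (borel \<Otimes>\<^sub>M D) \<and>
     (\<forall>x. integrable D (G x) \<and> (\<integral>s. G x s \<partial>D) = gradient f x \<and>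
          (\<integral>\<^sup>+s. ennreal ((norm (G x s - gradient f x))\<^sup>2) \<partial>D) \<le> ennreal (\<sigma>\<^sup>2))"

definition composite_problem ::
    "real \<Rightarrow> real \<Rightarrow> real \<Rightarrow> ('a::euclidean_space \<Rightarrow> real) \<Rightarrow> ('a \<Rightarrow> real) \<Rightarrow>
     's measure \<Rightarrow> ('a \<Rightarrow> 's \<Rightarrow> 'a) \<Rightarrow> bool" where
  "composite_problem L \<sigma> Fstar f \<psi> D G \<longleftrightarrow>
     0 < L \<and> 0 \<le> \<sigma> \<and> f differentiable_on UNIV \<and> \<psi> differentiable_on UNIV \<and>
     (\<forall>x. Fstar \<le> f x + \<psi> x) \<and> L_smooth L f \<and> unbiased_oracle D G f \<sigma>"

definition has_law :: "'w measure \<Rightarrow> 's measure \<Rightarrow> ('w \<Rightarrow> 's) \<Rightarrow> bool" where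
  "has_law \<Omega> D \<xi> \<longleftrightarrow> \<xi> \<in> measurable \<Omega> D \<and> distr \<Omega> D \<xi> = D"

text \<open>
  The library's \<open>indep_var\<close> needs two random variables of the same value type; this is the
  characterization \<open>indep_var_eq\<close> of it, for two possibly different types.
\<close>
definition indep_rv ::
    "'w measure \<Rightarrow> 's measure \<Rightarrow> ('w \<Rightarrow> 's) \<Rightarrow> 't measure \<Rightarrow> ('w \<Rightarrow> 't) \<Rightarrow> bool" where
  "indep_rv \<Omega> S X T Y \<longleftrightarrow>
     X \<in> measurable \<Omega> S \<and> Y \<in> measurable \<Omega> T \<and>
     prob_space.indep_set \<Omega>
       (sigma_sets (space \<Omega>) {X -` A \<inter> space \<Omega> | A. A \<in> sets S})
       (sigma_sets (space \<Omega>) {Y -` A \<inter> space \<Omega> | A. A \<in> sets T})"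

text \<open>
  \<open>g0\<close> is the gradient estimate of iteration 0 (single sample or mini-batch average); later
  estimates use one sample each.  \<open>\<gamma>i\<close> and \<open>mi\<close> stand for \<open>\<gamma>\<close> and \<open>m\<close> with index \<open>-1\<close>.
\<close>
fun stoch_grad ::
    "('a \<Rightarrow> 's \<Rightarrow> 'a) \<Rightarrow> ('w \<Rightarrow> 'a) \<Rightarrow> (nat \<Rightarrow> 'w \<Rightarrow> 's) \<Rightarrow> (nat \<Rightarrow> 'w \<Rightarrow> 'a) \<Rightarrow>
     nat \<Rightarrow> 'w \<Rightarrow> 'a" where
  "stoch_grad G g0 \<xi> x 0 \<omega> = g0 \<omega>"
| "stoch_grad G g0 \<xi> x (Suc k) \<omega> = G (x (Suc k) \<omega>) (\<xi> (Suc k) \<omega>)"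

fun momentum ::
    "real \<Rightarrow> (nat \<Rightarrow> real) \<Rightarrow> ('w \<Rightarrow> 'a::real_vector) \<Rightarrow> (nat \<Rightarrow> 'w \<Rightarrow> 'a) \<Rightarrow> nat \<Rightarrow> 'w \<Rightarrow> 'a" where
  "momentum \<gamma>i \<gamma> mi g 0 \<omega> = (1 - \<gamma>i) *\<^sub>R mi \<omega> + \<gamma>i *\<^sub>R g 0 \<omega>"
| "momentum \<gamma>i \<gamma> mi g (Suc k) \<omega> =
     (1 - \<gamma> k) *\<^sub>R momentum \<gamma>i \<gamma> mi g k \<omega> + \<gamma> k *\<^sub>R g (Suc k) \<omega>"

definition prox_model ::
    "('a::real_inner \<Rightarrow> real) \<Rightarrow> 'a \<Rightarrow> real \<Rightarrow> 'a \<Rightarrow> 'a \<Rightarrow> real" where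
  "prox_model \<psi> m M y x = inner m x + \<psi> x + M / 2 * (norm (x - y))\<^sup>2"

text \<open>
  \<open>x 0, \<dots>, x K\<close> are the iterates of \<open>K\<close> iterations with exact proximal steps.  Only the samples
  \<open>\<xi> 1, \<dots>, \<xi> (K - 1)\<close> occur here; the randomness of iteration 0 enters through \<open>g0\<close>.
\<close>
definition exact_prox_run ::
    "'w measure \<Rightarrow> 's measure \<Rightarrow> ('a::euclidean_space \<Rightarrow> 's \<Rightarrow> 'a) \<Rightarrow> ('a \<Rightarrow> real) \<Rightarrow>
     (nat \<Rightarrow> real) \<Rightarrow> real \<Rightarrow> (nat \<Rightarrow> real) \<Rightarrow> 'a \<Rightarrow> ('w \<Rightarrow> 'a) \<Rightarrow> ('w \<Rightarrow> 'a) \<Rightarrow>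
     nat \<Rightarrow> (nat \<Rightarrow> 'w \<Rightarrow> 's) \<Rightarrow> (nat \<Rightarrow> 'w \<Rightarrow> 'a) \<Rightarrow> bool" where
  "exact_prox_run \<Omega> D G \<psi> M \<gamma>i \<gamma> x0 mi g0 K \<xi> x \<longleftrightarrow>
     (let m = momentum \<gamma>i \<gamma> mi (stoch_grad G g0 \<xi> x) in
      (\<forall>k\<le>K. x k \<in> borel_measurable \<Omega>) \<and>
      (\<forall>\<omega>\<in>space \<Omega>. x 0 \<omega> = x0) \<and>
      (\<forall>k. Suc k < K \<longrightarrow>
         has_law \<Omega> D (\<xi> (Suc k)) \<and>
         indep_rv \<Omega> D (\<xi> (Suc k))
           (Pi\<^sub>M {..Suc k} (\<lambda>_. borel) \<Otimes>\<^sub>M (borel \<Otimes>\<^sub>M Pi\<^sub>M {..k} (\<lambda>_. borel)))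
           (\<lambda>\<omega>. (\<lambda>i\<in>{..Suc k}. x i \<omega>, mi \<omega>, \<lambda>i\<in>{..k}. m i \<omega>))) \<and>
      (\<forall>k<K. AE \<omega> in \<Omega>.
         prox_model \<psi> (m k \<omega>) (M k) (x k \<omega>) (x (Suc k) \<omega>)
           \<le> prox_model \<psi> (m k \<omega>) (M k) (x k \<omega>) (x k \<omega>) \<and>
         gradient (prox_model \<psi> (m k \<omega>) (M k) (x k \<omega>)) (x (Suc k) \<omega>) = 0))"

definition init_momentum ::
    "real \<Rightarrow> ('w \<Rightarrow> 'a::real_vector) \<Rightarrow> ('w \<Rightarrow> 'a) \<Rightarrow> 'w \<Rightarrow> 'a" where
  "init_momentum \<gamma>i mi g0 \<omega> = (1 - \<gamma>i) *\<^sub>R mi \<omega> + \<gamma>i *\<^sub>R g0 \<omega>"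

definition init_error_integrable ::
    "'w measure \<Rightarrow> ('a::euclidean_space \<Rightarrow> real) \<Rightarrow> 'a \<Rightarrow> ('w \<Rightarrow> 'a) \<Rightarrow> bool" where
  "init_error_integrable \<Omega> f x0 m0 \<longleftrightarrow>
     integrable \<Omega> (\<lambda>\<omega>. (norm (m0 \<omega> - gradient f x0))\<^sup>2)"

definition init_potential ::
    "'w measure \<Rightarrow> real \<Rightarrow> real \<Rightarrow> ('a::euclidean_space \<Rightarrow> real) \<Rightarrow> ('a \<Rightarrow> real) \<Rightarrow> 'a \<Rightarrow>
     ('w \<Rightarrow> 'a) \<Rightarrow> real" where
  "init_potential \<Omega> L Fstar f \<psi> x0 m0 =
     (f x0 + \<psi> x0 - Fstar)
       + 3 / (8 * L) * (\<integral>\<omega>. (norm (m0 \<omega> - gradient f x0))\<^sup>2 \<partial>\<Omega>)"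

text \<open>The index \<open>t\<close> is uniform on \<open>{1..K}\<close> and independent of \<open>\<Omega>\<close> because the measure is a product.\<close>
definition expected_sq_grad ::
    "'w measure \<Rightarrow> ('a::euclidean_space \<Rightarrow> real) \<Rightarrow> nat \<Rightarrow> (nat \<Rightarrow> 'w \<Rightarrow> 'a) \<Rightarrow> ennreal" where
  "expected_sq_grad \<Omega> F K x =
     (\<integral>\<^sup>+(\<omega>, t). ennreal ((norm (gradient F (x t \<omega>)))\<^sup>2)
        \<partial>(\<Omega> \<Otimes>\<^sub>M measure_pmf (pmf_of_set {1..K})))"

definition step_coeff :: "real \<Rightarrow> real \<Rightarrow> real \<Rightarrow> nat \<Rightarrow> real" where
  "step_coeff L \<sigma> \<Phi>0 K = 4 * L + 3 powr (3 / 2) / 2 * sqrt (real K * L * \<sigma>\<^sup>2 / \<Phi>0)"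

definition reaches_accuracy ::
    "'w measure \<Rightarrow> 's measure \<Rightarrow> ('a::euclidean_space \<Rightarrow> 's \<Rightarrow> 'a) \<Rightarrow> ('a \<Rightarrow> real) \<Rightarrow>
     ('a \<Rightarrow> real) \<Rightarrow> real \<Rightarrow> real \<Rightarrow> real \<Rightarrow> real \<Rightarrow> 'a \<Rightarrow> real \<Rightarrow> ('w \<Rightarrow> 'a) \<Rightarrow> ('w \<Rightarrow> 'a) \<Rightarrow>
     nat \<Rightarrow> bool" where
  "reaches_accuracy \<Omega> D G f \<psi> L \<sigma> Fstar \<epsilon> x0 \<gamma>i mi g0 K \<longleftrightarrow>
     (let M = step_coeff L \<sigma> (init_potential \<Omega> L Fstar f \<psi> x0 (init_momentum \<gamma>i mi g0)) K;
          \<gamma> = 3 * L / (M - L) in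
      \<forall>\<xi> x. exact_prox_run \<Omega> D G \<psi> (\<lambda>_. M) \<gamma>i (\<lambda>_. \<gamma>) x0 mi g0 K \<xi> x \<longrightarrow>
        expected_sq_grad \<Omega> (\<lambda>y. f y + \<psi> y) K x \<le> ennreal \<epsilon>)"

definition minibatch_gradient ::
    "('a::real_vector \<Rightarrow> 's \<Rightarrow> 'a) \<Rightarrow> 'a \<Rightarrow> nat \<Rightarrow> (nat \<Rightarrow> 'w \<Rightarrow> 's) \<Rightarrow> 'w \<Rightarrow> 'a" where
  "minibatch_gradient G x0 b \<zeta> \<omega> = (1 / real b) *\<^sub>R (\<Sum>i<b. G x0 (\<zeta> i \<omega>))"

text \<open>
  The maximum only matters for \<open>\<sigma> = 0\<close>, where the ceiling is 0 and no batch would be drawn.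
\<close>
definition batch_size :: "real \<Rightarrow> real \<Rightarrow> real \<Rightarrow> nat" where
  "batch_size L \<sigma> F0 = max 1 (nat \<lceil>\<sigma>\<^sup>2 / (L * F0)\<rceil>)"

text \<open>
  An initialization rule maps \<open>\<gamma>\<close> with index \<open>-1\<close> and \<open>g\<^sub>0\<close> to \<open>m\<close> with index \<open>-1\<close>.  Rules have to be
  chosen before the problem: otherwise a rule could contain the unknown vector \<open>\<nabla>f(x\<^sub>0)\<close> and
  make the initial error vanish.
\<close>
definition init_rule :: "(real \<Rightarrow> 'a::euclidean_space \<Rightarrow> 'a) \<Rightarrow> bool" where
  "init_rule h \<longleftrightarrow> (\<forall>\<gamma>i\<in>{0<..<1}. h \<gamma>i \<in> borel_measurable borel)"

text \<open>
  HOL cannot quantify over types below an existential quantifier, so a bare \<open>\<exists>C > 0\<close> in a statement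
  about \<open>real^'n\<close> and measures on types \<open>'w\<close>, \<open>'s\<close> would let \<open>C\<close> depend on the dimension and on these
  types.  Asking for \<open>C \<le> C_max\<close> with one fixed number makes it absolute: \<open>C\<close> occurs only in upper
  bounds on \<open>K\<close> that are monotone in \<open>C\<close>, so \<open>C_max\<close> itself then works for all types.
\<close>
definition C_max :: real where
  "C_max = 10 ^ 6"

end

theory Submission
  imports Defs
begin

text \<open>
  Write \<open>e\<^sub>k = m\<^sub>k - \<nabla>f(x\<^sub>k)\<close> for the error of the momentum, \<open>r\<^sub>k = \<parallel>x\<^sub>k\<^sub>+\<^sub>1 - x\<^sub>k\<parallel>\<close> for the length of a
  step, and \<open>N = M - L\<close>, so that \<open>N \<ge> 3L\<close> and \<open>\<gamma> = 3L/N \<in> (0,1]\<close>.  Three estimates carry the proof.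

  (a) A proximal step does not increase the model.  Together with \<open>L\<close>-smoothness of \<open>f\<close> and Young's
  inequality this gives \<open>F(x\<^sub>k\<^sub>+\<^sub>1) + (N/4) r\<^sub>k\<^sup>2 \<le> F(x\<^sub>k) + \<parallel>e\<^sub>k\<parallel>\<^sup>2/N\<close> (\<open>prox_step_decrease\<close>).

  (b) Stationarity of the step expresses \<open>\<nabla>F(x\<^sub>k\<^sub>+\<^sub>1)\<close> through \<open>e\<^sub>k\<close> and the displacement, so that
  \<open>\<parallel>\<nabla>F(x\<^sub>k\<^sub>+\<^sub>1)\<parallel>\<^sup>2 \<le> 4 (N\<^sup>2 r\<^sub>k\<^sup>2 + \<parallel>e\<^sub>k\<parallel>\<^sup>2)\<close> (\<open>prox_step_gradient_bound\<close>).

  (c) Averaging contracts the error: the fresh sample is independent of the past, its noise has mean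
  zero, and the drift \<open>\<nabla>f(x\<^sub>k) - \<nabla>f(x\<^sub>k\<^sub>+\<^sub>1)\<close> is at most \<open>L r\<^sub>k\<close>; hence
  \<open>E\<parallel>e\<^sub>k\<^sub>+\<^sub>1\<parallel>\<^sup>2 \<le> (1 - \<gamma>) E\<parallel>e\<^sub>k\<parallel>\<^sup>2 + (L\<^sup>2/\<gamma>) E r\<^sub>k\<^sup>2 + \<gamma>\<^sup>2\<sigma>\<^sup>2\<close> (\<open>expected_error_recursion\<close>).

  Adding (a) and \<open>3/(8L)\<close> times (c), the potential \<open>\<Phi>\<^sub>k = E[F(x\<^sub>k) - F\<^sup>*] + 3/(8L) E\<parallel>e\<^sub>k\<parallel>\<^sup>2\<close> loses
  \<open>(N\<^sup>2 E r\<^sub>k\<^sup>2 + E\<parallel>e\<^sub>k\<parallel>\<^sup>2)/(8N)\<close> in each iteration and gains at most \<open>27 L\<sigma>\<^sup>2/(8N\<^sup>2)\<close>.  Telescoping and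
  (b) bound the mean of \<open>E\<parallel>\<nabla>F(x\<^sub>t)\<parallel>\<^sup>2\<close> over \<open>t = 1, \<dots>, K\<close> by \<open>32N (\<Phi>\<^sub>0/K + 27 L\<sigma>\<^sup>2/(8N\<^sup>2))\<close>
  (\<open>expected_gradient_bound\<close>).  The prescribed \<open>M\<close> balances the two terms, so that this is of order
  \<open>L\<Phi>\<^sub>0/K + sqrt(L\<Phi>\<^sub>0\<sigma>\<^sup>2/K)\<close>, which is at most \<open>\<epsilon>\<close> once \<open>K\<close> exceeds a constant times
  \<open>L\<Phi>\<^sub>0\<sigma>\<^sup>2/\<epsilon>\<^sup>2 + L\<Phi>\<^sub>0/\<epsilon>\<close> (\<open>step_coeff_average_bound\<close>).

  It remains to bound \<open>L\<Phi>\<^sub>0\<close> for suitable starts.  For \<open>\<psi> = 0\<close>, choosing \<open>m\<^sub>-\<^sub>1\<close> so that \<open>m\<^sub>0 = 0\<close> works,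
  since a smooth function bounded below satisfies \<open>\<parallel>\<nabla>f(x\<^sub>0)\<parallel>\<^sup>2 \<le> 2LF\<^sub>0\<close>.  In general \<open>m\<^sub>0 = g\<^sub>0\<close> has an
  error of at most \<open>\<sigma>\<^sup>2\<close>, and \<open>b\<^sub>0 \<ge> \<sigma>\<^sup>2/(LF\<^sub>0)\<close> independent samples lower it to \<open>\<sigma>\<^sup>2/b\<^sub>0 \<le> LF\<^sub>0\<close>.
\<close>

section \<open>Gradients and the descent lemma\<close>

lemma gradient_add:
  fixes f g :: "'a::euclidean_space \<Rightarrow> real"
  assumes "f differentiable (at x)" "g differentiable (at x)"
  shows "gradient (\<lambda>y. f y + g y) x = gradient f x + gradient g x"
  using assms by (intro gradient_eqI GDERIV_add GDERIV_gradient)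

lemma gradient_prox_model:
  fixes \<psi> :: "'a::euclidean_space \<Rightarrow> real"
  assumes "\<psi> differentiable (at x)"
  shows "gradient (prox_model \<psi> m M y) x = m + gradient \<psi> x + M *\<^sub>R (x - y)"
proof (rule gradient_eqI)
  have \<psi>: "(\<psi> has_derivative (\<lambda>h. inner h (gradient \<psi> x))) (at x)"
    using GDERIV_gradient[OF assms] by (simp add: gderiv_def)
  have "((\<lambda>x. inner m x + \<psi> x + M / 2 * inner (x - y) (x - y)) has_derivative
      (\<lambda>h. inner h (m + gradient \<psi> x + M *\<^sub>R (x - y)))) (at x)"
    by (auto intro!: derivative_eq_intros \<psi>
        simp: fun_eq_iff algebra_simps inner_add inner_diff inner_commute)
  then show "GDERIV (prox_model \<psi> m M y) x :> m + gradient \<psi> x + M *\<^sub>R (x - y)"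
    by (simp add: gderiv_def prox_model_def[abs_def] power2_norm_eq_inner)
qed

lemma continuous_on_gradient:
  assumes "L_smooth L f" "0 < L"
  shows "continuous_on UNIV (gradient f)"
proof -
  have "L-lipschitz_on UNIV (gradient f)"
    using assms by (auto simp: L_smooth_def lipschitz_on_def dist_norm)
  then show ?thesis by (rule lipschitz_on_continuous_on)
qed

text \<open>
  The difference \<open>\<phi>\<close> of the two sides along the segment from \<open>x\<close> to \<open>y\<close> is nonincreasing, because the
  Lipschitz bound on the gradient makes its derivative nonpositive.
\<close>
lemma L_smooth_quadratic_bound:
  fixes f :: "'a::euclidean_space \<Rightarrow> real"
  assumes diff: "f differentiable_on UNIV" and L: "L_smooth L f"
  shows "f y \<le> f x + inner (gradient f x) (y - x) + L / 2 * (norm (y - x))\<^sup>2"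
proof -
  define d where "d = y - x"
  define \<phi> where "\<phi> t = f (x + t *\<^sub>R d) - t * inner (gradient f x) d - L / 2 * t\<^sup>2 * (norm d)\<^sup>2"
    for t :: real
  have "\<phi> 1 \<le> \<phi> 0"
  proof (rule DERIV_nonpos_imp_nonincreasing[where f = \<phi>])
    fix t :: real assume t: "0 \<le> t" "t \<le> 1"
    let ?D = "inner (gradient f (x + t *\<^sub>R d) - gradient f x) d - L * t * (norm d)\<^sup>2"
    have "(f has_derivative (\<lambda>h. inner h (gradient f (x + t *\<^sub>R d)))) (at (x + t *\<^sub>R d))"
      using GDERIV_gradient[of f "x + t *\<^sub>R d"] diff by (simp add: gderiv_def differentiable_on_def)
    moreover have "((\<lambda>t. x + t *\<^sub>R d) has_derivative (\<lambda>h. h *\<^sub>R d)) (at t)"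
      by (auto intro!: derivative_eq_intros)
    ultimately have "((\<lambda>t. f (x + t *\<^sub>R d)) has_derivative (\<lambda>h. inner (h *\<^sub>R d) (gradient f (x + t *\<^sub>R d)))) (at t)"
      using has_derivative_compose by blast
    then have "((\<lambda>t. f (x + t *\<^sub>R d)) has_real_derivative inner (gradient f (x + t *\<^sub>R d)) d) (at t)"
      by (simp add: has_field_derivative_def inner_commute mult_commute_abs)
    then have "(\<phi> has_real_derivative ?D) (at t)"
      unfolding \<phi>_def by (auto intro!: derivative_eq_intros simp: inner_diff_left)
    moreover have "norm (gradient f (x + t *\<^sub>R d) - gradient f x) \<le> L * norm (x + t *\<^sub>R d - x)"
      using L unfolding L_smooth_def by blast
    then have "inner (gradient f (x + t *\<^sub>R d) - gradient f x) d \<le> L * norm (x + t *\<^sub>R d - x) * norm d"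
      by (intro order.trans[OF norm_cauchy_schwarz] mult_right_mono) auto
    then have "?D \<le> 0" using t by (simp add: power2_eq_square mult_ac)
    ultimately show "\<exists>D. DERIV \<phi> t :> D \<and> D \<le> 0" by blast
  qed simp
  then show ?thesis by (simp add: \<phi>_def d_def)
qed

text \<open>
  A gradient step of length \<open>1/L\<close> lowers \<open>f\<close> by at least \<open>\<parallel>\<nabla>f(x)\<parallel>\<^sup>2/(2L)\<close>, and it cannot go below \<open>c\<close>.
\<close>
lemma L_smooth_gradient_bound:
  fixes f :: "'a::euclidean_space \<Rightarrow> real"
  assumes "f differentiable_on UNIV" "L_smooth L f" "0 < L" and lower: "\<And>y. c \<le> f y"
  shows "(norm (gradient f x))\<^sup>2 \<le> 2 * L * (f x - c)"
proof -
  let ?g = "gradient f x"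
  have "c \<le> f (x - (1 / L) *\<^sub>R ?g)" by (rule lower)
  also have "\<dots> \<le> f x + inner ?g (- (1 / L) *\<^sub>R ?g) + L / 2 * (norm ((1 / L) *\<^sub>R ?g))\<^sup>2"
    using L_smooth_quadratic_bound[OF assms(1,2), of "x - (1 / L) *\<^sub>R ?g" x] by simp
  also have "\<dots> = f x - (norm ?g)\<^sup>2 / (2 * L)"
    using \<open>0 < L\<close> by (simp add: power2_norm_eq_inner[symmetric] power2_eq_square field_simps)
  finally show ?thesis using \<open>0 < L\<close> by (simp add: field_simps)
qed

section \<open>Estimates for a single proximal step\<close>

lemma norm_linear_combination_sq:
  fixes a b :: "'a::real_inner"
  shows "(norm (s *\<^sub>R a + t *\<^sub>R b))\<^sup>2 = s\<^sup>2 * (norm a)\<^sup>2 + 2 * s * t * inner a b + t\<^sup>2 * (norm b)\<^sup>2"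
  unfolding power2_norm_eq_inner
  by (simp add: inner_add inner_commute algebra_simps power2_eq_square)

lemma young_norm:
  fixes a b :: "'a::real_inner"
  assumes "0 < \<beta>"
  shows "(norm (a + b))\<^sup>2 \<le> (1 + \<beta>) * (norm a)\<^sup>2 + (1 + 1 / \<beta>) * (norm b)\<^sup>2"
proof -
  have "0 \<le> (norm (\<beta> *\<^sub>R a + (- 1) *\<^sub>R b))\<^sup>2 / \<beta>" using assms by simp
  also have "\<dots> = \<beta> * (norm a)\<^sup>2 + (norm b)\<^sup>2 / \<beta> - 2 * inner a b"
    unfolding norm_linear_combination_sq using assms by (simp add: field_simps power2_eq_square)
  finally show ?thesis
    using norm_linear_combination_sq[of 1 a 1 b] by (simp add: algebra_simps)
qed

text \<open>
  Adding the model inequality and the descent lemma leaves \<open>-\<langle>e, d\<rangle> - (N/2) \<parallel>d\<parallel>\<^sup>2\<close> with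
  \<open>e = m - \<nabla>f(x)\<close> and \<open>d = y - x\<close>.  Young's inequality is applied with the weights that spend exactly
  half of the quadratic term; the other half has to pay for the drift of the gradient in the error
  recursion.
\<close>
lemma prox_step_decrease:
  fixes f \<psi> :: "'a::euclidean_space \<Rightarrow> real"
  assumes "f differentiable_on UNIV" "L_smooth L f" "L < M"
    and dec: "prox_model \<psi> m M x y \<le> prox_model \<psi> m M x x"
  shows "f y + \<psi> y + (M - L) / 4 * (norm (y - x))\<^sup>2
           \<le> f x + \<psi> x + (norm (m - gradient f x))\<^sup>2 / (M - L)"
proof -
  define e d N where "e = m - gradient f x" and "d = y - x" and "N = M - L"
  have N: "0 < N" using assms by (simp add: N_def)
  \<comment> \<open>Young with weights \<open>1/N\<close> and \<open>N/4\<close>, obtained by completing the square.\<close>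
  have "0 \<le> (norm (2 *\<^sub>R e + N *\<^sub>R d))\<^sup>2 / (4 * N)" using N by simp
  also have "\<dots> = (norm e)\<^sup>2 / N + N / 4 * (norm d)\<^sup>2 + inner e d"
    unfolding norm_linear_combination_sq using N by (simp add: field_simps power2_eq_square)
  finally have ed: "- inner e d \<le> (norm e)\<^sup>2 / N + N / 4 * (norm d)\<^sup>2" by simp
  have "inner m d + \<psi> y + M / 2 * (norm d)\<^sup>2 \<le> \<psi> x"
    using dec by (simp add: prox_model_def d_def inner_diff_right)
  moreover have "f y \<le> f x + inner (gradient f x) d + L / 2 * (norm d)\<^sup>2"
    unfolding d_def by (rule L_smooth_quadratic_bound) fact+
  moreover have "inner e d = inner m d - inner (gradient f x) d"
    by (simp add: e_def inner_diff_left)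
  ultimately have "f y + \<psi> y + N / 2 * (norm d)\<^sup>2 \<le> f x + \<psi> x - inner e d"
    unfolding N_def by (simp add: algebra_simps diff_divide_distrib)
  with ed show ?thesis unfolding e_def d_def N_def by (simp add: field_simps)
qed

text \<open>
  Stationarity gives \<open>\<nabla>\<psi>(y) = -m - M(y - x)\<close>, so that only the drift of \<open>\<nabla>f\<close>, the momentum error and
  the displacement remain in \<open>\<nabla>F(y)\<close>.  The drift is absorbed into the displacement:
  \<open>M + L \<le> 5/3 (M - L)\<close> since \<open>M \<ge> 4L\<close>.
\<close>
lemma prox_step_gradient_bound:
  fixes f \<psi> :: "'a::euclidean_space \<Rightarrow> real"
  assumes "f differentiable_on UNIV" "\<psi> differentiable_on UNIV" "L_smooth L f"
    and "0 < L" "4 * L \<le> M"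
    and stat: "gradient (prox_model \<psi> m M x) y = 0"
  shows "(norm (gradient (\<lambda>z. f z + \<psi> z) y))\<^sup>2
           \<le> 4 * ((M - L)\<^sup>2 * (norm (y - x))\<^sup>2 + (norm (m - gradient f x))\<^sup>2)"
proof -
  define e d where "e = norm (m - gradient f x)" and "d = norm (y - x)"
  have diff: "f differentiable (at y)" "\<psi> differentiable (at y)"
    using assms by (auto simp: differentiable_on_def)
  have "m + gradient \<psi> y + M *\<^sub>R (y - x) = 0"
    using stat gradient_prox_model[OF diff(2)] by simp
  then have eq: "gradient (\<lambda>z. f z + \<psi> z) y
      = (gradient f y - gradient f x) - (m - gradient f x) - M *\<^sub>R (y - x)"
    using gradient_add[OF diff] by (simp add: algebra_simps add_eq_0_iff)
  have "norm (gradient f y - gradient f x) \<le> L * d"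
    using assms unfolding L_smooth_def d_def by blast
  moreover have "norm (M *\<^sub>R (y - x)) = M * d" using assms by (simp add: d_def)
  ultimately have "norm (gradient (\<lambda>z. f z + \<psi> z) y) \<le> L * d + e + M * d"
    unfolding eq e_def
    using norm_triangle_ineq4[of "gradient f y - gradient f x - (m - gradient f x)" "M *\<^sub>R (y - x)"]
      norm_triangle_ineq4[of "gradient f y - gradient f x" "m - gradient f x"] by linarith
  also have "\<dots> \<le> 5 / 3 * ((M - L) * d) + e"
    using mult_right_mono[of "4 * L" M d] assms by (simp add: d_def algebra_simps)
  finally have "(norm (gradient (\<lambda>z. f z + \<psi> z) y))\<^sup>2 \<le> (5 / 3 * ((M - L) * d) + e)\<^sup>2"
    by (intro power_mono) auto
  also have "(5 / 3 * u + e)\<^sup>2 \<le> 4 * (u\<^sup>2 + e\<^sup>2)" for u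
  proof -
    have "0 \<le> (3 * u - 5 * e)\<^sup>2 + 2 * (u\<^sup>2 + e\<^sup>2)" by simp
    then show ?thesis by (simp add: power2_eq_square field_simps)
  qed
  finally show ?thesis by (simp add: e_def d_def power_mult_distrib)
qed

section \<open>The stochastic gradient oracle\<close>

lemma composite_problemD:
  assumes "composite_problem L \<sigma> Fstar f \<psi> D G"
  shows "0 < L" "0 \<le> \<sigma>" "f differentiable_on UNIV" "\<psi> differentiable_on UNIV"
    "Fstar \<le> f x + \<psi> x" "L_smooth L f" "prob_space D"
    "(\<lambda>(x, s). G x s) \<in> borel_measurable (borel \<Otimes>\<^sub>M D)"
    "integrable D (G x)" "(\<integral>s. G x s \<partial>D) = gradient f x"
    "(\<integral>\<^sup>+s. ennreal ((norm (G x s - gradient f x))\<^sup>2) \<partial>D) \<le> ennreal (\<sigma>\<^sup>2)"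
  using assms unfolding composite_problem_def unbiased_oracle_def by blast+

text \<open>
  The variance assumption is about a nonnegative integral; this turns it into integrability and a
  bound on the Bochner integral.
\<close>
lemma oracle_noise_moment:
  assumes "composite_problem L \<sigma> Fstar f \<psi> D G"
  shows "integrable D (\<lambda>s. (norm (G x s - gradient f x))\<^sup>2)"
    and "(\<integral>s. (norm (G x s - gradient f x))\<^sup>2 \<partial>D) \<le> \<sigma>\<^sup>2"
proof -
  note P = composite_problemD[OF assms]
  have [measurable]: "G x \<in> borel_measurable D" using P(9) by (rule borel_measurable_integrable)
  show int: "integrable D (\<lambda>s. (norm (G x s - gradient f x))\<^sup>2)"
    using le_less_trans[OF P(11)[of x] ennreal_less_top] by (intro integrableI_bounded) auto
  have "ennreal (\<integral>s. (norm (G x s - gradient f x))\<^sup>2 \<partial>D) \<le> ennreal (\<sigma>\<^sup>2)"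
    using P(11)[of x] by (subst nn_integral_eq_integral[symmetric]) (auto intro: int)
  then show "(\<integral>s. (norm (G x s - gradient f x))\<^sup>2 \<partial>D) \<le> \<sigma>\<^sup>2" by (simp add: ennreal_le_iff)
qed

text \<open>
  The cross term vanishes since the oracle is unbiased.  The left-hand side is a nonnegative integral
  because it will appear inside an integral over the past, before integrability is known there.
\<close>
lemma oracle_perturbation_moment:
  assumes "composite_problem L \<sigma> Fstar f \<psi> D G"
  shows "(\<integral>\<^sup>+s. ennreal ((norm (a + \<gamma> *\<^sub>R (G x s - gradient f x)))\<^sup>2) \<partial>D)
           \<le> ennreal ((norm a)\<^sup>2 + \<gamma>\<^sup>2 * \<sigma>\<^sup>2)"
proof -
  note P = composite_problemD[OF assms]
  interpret D: prob_space D by (rule P)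
  let ?Y = "\<lambda>s. G x s - gradient f x"
  note N = oracle_noise_moment[OF assms, of x]
  have Y: "integrable D ?Y" "(\<integral>s. ?Y s \<partial>D) = 0"
    using P(9,10)[of x] by (simp_all add: D.prob_space)
  have eq: "(norm (a + \<gamma> *\<^sub>R ?Y s))\<^sup>2 = (norm a)\<^sup>2 + 2 * \<gamma> * inner a (?Y s) + \<gamma>\<^sup>2 * (norm (?Y s))\<^sup>2" for s
    using norm_linear_combination_sq[of 1 a \<gamma> "?Y s"] by simp
  have inn: "integrable D (\<lambda>s. inner a (?Y s))" using Y(1) by (rule integrable_inner_right)
  have "(\<integral>\<^sup>+s. ennreal ((norm (a + \<gamma> *\<^sub>R ?Y s))\<^sup>2) \<partial>D)
      = ennreal (\<integral>s. (norm (a + \<gamma> *\<^sub>R ?Y s))\<^sup>2 \<partial>D)"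
  proof (rule nn_integral_eq_integral)
    show "integrable D (\<lambda>s. (norm (a + \<gamma> *\<^sub>R ?Y s))\<^sup>2)"
      unfolding eq using inn N(1) by simp
  qed simp
  also have "(\<integral>s. (norm (a + \<gamma> *\<^sub>R ?Y s))\<^sup>2 \<partial>D)
      = (norm a)\<^sup>2 + 2 * \<gamma> * (\<integral>s. inner a (?Y s) \<partial>D) + \<gamma>\<^sup>2 * (\<integral>s. (norm (?Y s))\<^sup>2 \<partial>D)"
    unfolding eq using inn N(1) by (simp add: D.prob_space)
  also have "(\<integral>s. inner a (?Y s) \<partial>D) = 0"
    using integral_inner_right[OF Y(1), of a] Y(2) by simp
  finally show ?thesis using N(2) by (auto intro!: ennreal_leI mult_left_mono)
qed

section \<open>Independent random vectors\<close>

text \<open>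
  Independence makes the joint law the product of the marginals, so one may first average over \<open>X\<close>
  with the value of \<open>Y\<close> held fixed.  This takes the place of conditional expectations.
\<close>
lemma nn_integral_indep_rv:
  assumes "prob_space \<Omega>" "indep_rv \<Omega> S X T Y" and h: "h \<in> borel_measurable (S \<Otimes>\<^sub>M T)"
  shows "(\<integral>\<^sup>+\<omega>. h (X \<omega>, Y \<omega>) \<partial>\<Omega>) = (\<integral>\<^sup>+\<omega>. (\<integral>\<^sup>+s. h (s, Y \<omega>) \<partial>distr \<Omega> S X) \<partial>\<Omega>)"
proof -
  interpret prob_space \<Omega> by fact
  have X[measurable]: "X \<in> measurable \<Omega> S" and Y[measurable]: "Y \<in> measurable \<Omega> T"
    and ind: "indep_set (sigma_sets (space \<Omega>) {X -` A \<inter> space \<Omega> | A. A \<in> sets S})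
       (sigma_sets (space \<Omega>) {Y -` A \<inter> space \<Omega> | A. A \<in> sets T})"
    using assms(2) by (auto simp: indep_rv_def)
  interpret DX: prob_space "distr \<Omega> S X" by (rule prob_space_distr) fact
  interpret DY: prob_space "distr \<Omega> T Y" by (rule prob_space_distr) fact
  interpret XY: pair_sigma_finite "distr \<Omega> S X" "distr \<Omega> T Y" ..
  have joint: "distr \<Omega> S X \<Otimes>\<^sub>M distr \<Omega> T Y = distr \<Omega> (S \<Otimes>\<^sub>M T) (\<lambda>\<omega>. (X \<omega>, Y \<omega>))"
  proof (rule pair_measure_eqI)
    fix A B assume "A \<in> sets (distr \<Omega> S X)" "B \<in> sets (distr \<Omega> T Y)"
    then have A[measurable]: "A \<in> sets S" and B[measurable]: "B \<in> sets T" by auto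
    have "prob ((X -` A \<inter> space \<Omega>) \<inter> (Y -` B \<inter> space \<Omega>))
        = prob (X -` A \<inter> space \<Omega>) * prob (Y -` B \<inter> space \<Omega>)"
      using A B by (intro indep_setD[OF ind] sigma_sets.Basic) auto
    moreover have "(\<lambda>\<omega>. (X \<omega>, Y \<omega>)) -` (A \<times> B) \<inter> space \<Omega>
        = (X -` A \<inter> space \<Omega>) \<inter> (Y -` B \<inter> space \<Omega>)" by auto
    ultimately show "emeasure (distr \<Omega> S X) A * emeasure (distr \<Omega> T Y) B
        = emeasure (distr \<Omega> (S \<Otimes>\<^sub>M T) (\<lambda>\<omega>. (X \<omega>, Y \<omega>))) (A \<times> B)"
      by (simp add: emeasure_distr emeasure_eq_measure ennreal_mult'')
  qed (auto intro: DX.sigma_finite_measure_axioms DY.sigma_finite_measure_axioms)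
  have "(\<integral>\<^sup>+\<omega>. h (X \<omega>, Y \<omega>) \<partial>\<Omega>) = integral\<^sup>N (distr \<Omega> S X \<Otimes>\<^sub>M distr \<Omega> T Y) h"
    unfolding joint using h by (subst nn_integral_distr) auto
  also have "\<dots> = (\<integral>\<^sup>+y. \<integral>\<^sup>+s. h (s, y) \<partial>distr \<Omega> S X \<partial>distr \<Omega> T Y)"
    using h by (subst XY.nn_integral_snd) auto
  also have "\<dots> = (\<integral>\<^sup>+\<omega>. (\<integral>\<^sup>+s. h (s, Y \<omega>) \<partial>distr \<Omega> S X) \<partial>\<Omega>)"
    using h by (subst nn_integral_distr) (auto intro!: DX.borel_measurable_nn_integral)
  finally show ?thesis .
qed

text \<open>
  Bienayme's identity for centred vectors: the mixed terms \<open>E\<langle>Y\<^sub>i, Y\<^sub>j\<rangle>\<close> vanish coordinate by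
  coordinate.
\<close>
lemma (in prob_space) second_moment_sum_indep:
  fixes Y :: "'i \<Rightarrow> 'a \<Rightarrow> 'b::euclidean_space"
  assumes ind: "indep_vars (\<lambda>_. borel) Y I"
    and sq: "\<And>i. i \<in> I \<Longrightarrow> integrable M (\<lambda>\<omega>. (norm (Y i \<omega>))\<^sup>2)"
    and mean: "\<And>i. i \<in> I \<Longrightarrow> expectation (Y i) = 0"
  shows "integrable M (\<lambda>\<omega>. (norm (\<Sum>i\<in>I. Y i \<omega>))\<^sup>2)"
    and "expectation (\<lambda>\<omega>. (norm (\<Sum>i\<in>I. Y i \<omega>))\<^sup>2) = (\<Sum>i\<in>I. expectation (\<lambda>\<omega>. (norm (Y i \<omega>))\<^sup>2))"
proof -
  have meas[measurable]: "Y i \<in> borel_measurable M" if "i \<in> I" for i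
    using ind that by (auto simp: indep_vars_def)
  have integ: "integrable M (Y i)" if "i \<in> I" for i
  proof (rule Bochner_Integration.integrable_bound)
    show "integrable M (\<lambda>\<omega>. 1 + (norm (Y i \<omega>))\<^sup>2)" using sq[OF that] by simp
    show "AE \<omega> in M. norm (Y i \<omega>) \<le> norm (1 + (norm (Y i \<omega>))\<^sup>2)"
    proof (rule AE_I2)
      fix \<omega>
      have "0 \<le> (norm (Y i \<omega>) - 1)\<^sup>2 + (norm (Y i \<omega>))\<^sup>2 + 1" by simp
      then show "norm (Y i \<omega>) \<le> norm (1 + (norm (Y i \<omega>))\<^sup>2)"
        by (simp add: power2_eq_square algebra_simps)
    qed
  qed (use that in measurable)
  have cross: "integrable M (\<lambda>\<omega>. inner (Y i \<omega>) (Y j \<omega>)) \<and>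
      expectation (\<lambda>\<omega>. inner (Y i \<omega>) (Y j \<omega>)) = (if i = j then expectation (\<lambda>\<omega>. (norm (Y i \<omega>))\<^sup>2) else 0)"
    if "i \<in> I" "j \<in> I" for i j
  proof (cases "i = j")
    case True
    then show ?thesis using sq[OF that(1)] by (simp add: power2_norm_eq_inner)
  next
    case False
    have "indep_var borel (Y i) borel (Y j)"
      using indep_var_compose[OF indep_var_restrict[OF ind, of "{i}" "{j}"],
          of "\<lambda>v. v i" borel "\<lambda>v. v j" borel] that False
      by (simp add: comp_def)
    then have ib: "indep_var borel (\<lambda>\<omega>. inner (Y i \<omega>) b) borel (\<lambda>\<omega>. inner (Y j \<omega>) b)" for b
      using indep_var_compose[of borel "Y i" borel "Y j" "\<lambda>v. inner v b" borel "\<lambda>v. inner v b" borel]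
      by (simp add: comp_def)
    have 1: "integrable M (\<lambda>\<omega>. inner (Y i \<omega>) b * inner (Y j \<omega>) b)" for b
      using integ[OF that(1)] integ[OF that(2)] by (intro indep_var_integrable[OF ib]) auto
    have 2: "expectation (\<lambda>\<omega>. inner (Y i \<omega>) b * inner (Y j \<omega>) b) = 0" for b
      using integ[OF that(1)] integ[OF that(2)] integral_inner_left[OF integ[OF that(1)], of b] mean[OF that(1)]
      by (subst indep_var_lebesgue_integral[OF ib]) auto
    show ?thesis using False 1 2
      by (subst (1 2) euclidean_inner) (simp add: Bochner_Integration.integral_sum)
  qed
  have eq: "(norm (\<Sum>i\<in>I. Y i \<omega>))\<^sup>2 = (\<Sum>i\<in>I. \<Sum>j\<in>I. inner (Y i \<omega>) (Y j \<omega>))" for \<omega>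
    by (simp only: power2_norm_eq_inner inner_sum_left) (simp only: inner_sum_right)
  show "integrable M (\<lambda>\<omega>. (norm (\<Sum>i\<in>I. Y i \<omega>))\<^sup>2)"
    unfolding eq using cross by auto
  have "expectation (\<lambda>\<omega>. (norm (\<Sum>i\<in>I. Y i \<omega>))\<^sup>2)
      = (\<Sum>i\<in>I. \<Sum>j\<in>I. expectation (\<lambda>\<omega>. inner (Y i \<omega>) (Y j \<omega>)))"
    unfolding eq using cross by (simp add: Bochner_Integration.integral_sum)
  also have "\<dots> = (\<Sum>i\<in>I. \<Sum>j\<in>I. if i = j then expectation (\<lambda>\<omega>. (norm (Y i \<omega>))\<^sup>2) else 0)"
    using cross by (intro sum.cong refl) auto
  also have "\<dots> = (\<Sum>i\<in>I. expectation (\<lambda>\<omega>. (norm (Y i \<omega>))\<^sup>2))"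
    by (cases "finite I") (auto simp: sum.delta)
  finally show "expectation (\<lambda>\<omega>. (norm (\<Sum>i\<in>I. Y i \<omega>))\<^sup>2) = (\<Sum>i\<in>I. expectation (\<lambda>\<omega>. (norm (Y i \<omega>))\<^sup>2))" .
qed

text \<open>
  Measurability and the pointwise bound are available only for the functions \<open>v t\<close> with \<open>t \<in> {1..K}\<close>,
  one index at a time.  The \<open>v t\<close> are therefore glued to a function \<open>H\<close> on the product that dominates \<open>u\<close> almost
  everywhere, and Fubini is applied to \<open>H\<close>.
\<close>
lemma nn_integral_uniform_index_le:
  fixes u :: "'w \<Rightarrow> nat \<Rightarrow> ennreal"
  assumes "prob_space \<Omega>" "1 \<le> K"
    and v: "\<And>t. t \<in> {1..K} \<Longrightarrow> v t \<in> borel_measurable \<Omega>"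
    and le: "\<And>t. t \<in> {1..K} \<Longrightarrow> AE \<omega> in \<Omega>. u \<omega> t \<le> v t \<omega>"
  shows "(\<integral>\<^sup>+(\<omega>, t). u \<omega> t \<partial>(\<Omega> \<Otimes>\<^sub>M measure_pmf (pmf_of_set {1..K})))
           \<le> (\<Sum>t\<in>{1..K}. \<integral>\<^sup>+\<omega>. v t \<omega> \<partial>\<Omega>) / of_nat K"
proof -
  interpret prob_space \<Omega> by fact
  let ?P = "pmf_of_set {1..K}"
  interpret pair_sigma_finite \<Omega> "measure_pmf ?P" ..
  define H where "H p = (\<Sum>s\<in>{1..K}. v s (fst p) * indicator {s} (snd p))" for p :: "'w \<times> nat"
  have H: "H \<in> borel_measurable (\<Omega> \<Otimes>\<^sub>M measure_pmf ?P)"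
    unfolding H_def
  proof (intro borel_measurable_sum borel_measurable_times_ennreal)
    fix s assume s: "s \<in> {1..K}"
    show "(\<lambda>p. v s (fst p)) \<in> borel_measurable (\<Omega> \<Otimes>\<^sub>M measure_pmf ?P)"
      by (rule measurable_compose[OF measurable_fst v[OF s]])
    show "(\<lambda>p. indicator {s} (snd p) :: ennreal) \<in> borel_measurable (\<Omega> \<Otimes>\<^sub>M measure_pmf ?P)"
      by (rule measurable_compose[OF measurable_snd]) simp
  qed
  have H_eq: "H (\<omega>, t) = v t \<omega>" if "t \<in> {1..K}" for \<omega> t
    using that unfolding H_def by (subst sum.remove[of _ t]) (auto simp: indicator_def)
  have "AE \<omega> in \<Omega>. \<forall>t\<in>{1..K}. u \<omega> t \<le> v t \<omega>"
    by (rule AE_finite_allI) (use le in auto)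
  moreover have proj: "distr (\<Omega> \<Otimes>\<^sub>M measure_pmf ?P) \<Omega> fst = \<Omega>"
    by (rule measure_pmf.distr_pair_fst)
  ultimately have "AE \<omega> in distr (\<Omega> \<Otimes>\<^sub>M measure_pmf ?P) \<Omega> fst. \<forall>t\<in>{1..K}. u \<omega> t \<le> v t \<omega>"
    by (simp only:)
  then have "AE p in \<Omega> \<Otimes>\<^sub>M measure_pmf ?P. \<forall>t\<in>{1..K}. u (fst p) t \<le> v t (fst p)"
    by (rule AE_distrD[OF measurable_fst])
  moreover have "AE p in \<Omega> \<Otimes>\<^sub>M measure_pmf ?P. snd p \<in> {1..K}"
  proof (rule AE_pair_measure)
    show "{p \<in> space (\<Omega> \<Otimes>\<^sub>M measure_pmf ?P). snd p \<in> {1..K}} \<in> sets (\<Omega> \<Otimes>\<^sub>M measure_pmf ?P)"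
      by (rule measurable_sets_Collect[OF measurable_snd]) simp
  qed (use assms(2) in \<open>auto simp: AE_measure_pmf_iff\<close>)
  ultimately have "AE p in \<Omega> \<Otimes>\<^sub>M measure_pmf ?P. (case p of (\<omega>, t) \<Rightarrow> u \<omega> t) \<le> H p"
    by eventually_elim (auto simp: H_eq)
  then have "(\<integral>\<^sup>+(\<omega>, t). u \<omega> t \<partial>(\<Omega> \<Otimes>\<^sub>M measure_pmf ?P)) \<le> integral\<^sup>N (\<Omega> \<Otimes>\<^sub>M measure_pmf ?P) H"
    by (rule nn_integral_mono_AE)
  also have "\<dots> = (\<integral>\<^sup>+t. \<integral>\<^sup>+\<omega>. H (\<omega>, t) \<partial>\<Omega> \<partial>measure_pmf ?P)"
    by (rule nn_integral_snd[OF H, symmetric])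
  also have "\<dots> = (\<Sum>t\<in>{1..K}. \<integral>\<^sup>+\<omega>. H (\<omega>, t) \<partial>\<Omega>) / of_nat K"
    using assms(2) by (subst nn_integral_pmf_of_set) auto
  also have "(\<Sum>t\<in>{1..K}. \<integral>\<^sup>+\<omega>. H (\<omega>, t) \<partial>\<Omega>) = (\<Sum>t\<in>{1..K}. \<integral>\<^sup>+\<omega>. v t \<omega> \<partial>\<Omega>)"
    by (intro sum.cong refl) (simp add: H_eq)
  finally show ?thesis .
qed

section \<open>The Lyapunov recursion\<close>

text \<open>
  The deterministic core, for \<open>F k = E[F(x\<^sub>k) - F\<^sup>*]\<close>, \<open>a k = E\<parallel>e\<^sub>k\<parallel>\<^sup>2\<close>, \<open>r k = E\<parallel>x\<^sub>k\<^sub>+\<^sub>1 - x\<^sub>k\<parallel>\<^sup>2\<close> and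
  \<open>N = M - L\<close>.  The weight \<open>c = 3/(8L)\<close> of the error in the potential satisfies \<open>c\<gamma> = 9/(8N)\<close> and
  \<open>c L\<^sup>2/\<gamma> = N/8\<close>.  So the contraction pays for the \<open>a/N\<close> in the decrease and leaves \<open>a/(8N)\<close>, and the
  \<open>N r/4\<close> gained in the decrease pays for the drift and leaves \<open>N r/8\<close>.
\<close>
lemma momentum_telescope:
  fixes F a r :: "nat \<Rightarrow> real"
  assumes L: "0 < L" "3 * L \<le> N" and \<gamma>: "\<gamma> = 3 * L / N"
    and dec: "\<And>k. k < K \<Longrightarrow> F (Suc k) + N / 4 * r k \<le> F k + a k / N"
    and err: "\<And>k. Suc k < K \<Longrightarrow> a (Suc k) \<le> (1 - \<gamma>) * a k + L\<^sup>2 / \<gamma> * r k + \<gamma>\<^sup>2 * \<sigma>\<^sup>2"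
    and nonneg: "\<And>k. 0 \<le> F k" "\<And>k. 0 \<le> a k" "\<And>k. 0 \<le> r k"
  shows "(\<Sum>k<K. N\<^sup>2 * r k + a k)
           \<le> 8 * N * (F 0 + 3 / (8 * L) * a 0 + real K * (27 * L * \<sigma>\<^sup>2 / (8 * N\<^sup>2)))"
proof -
  define c \<delta> where "c = 3 / (8 * L)" and "\<delta> = 27 * L * \<sigma>\<^sup>2 / (8 * N\<^sup>2)"
  define S where "S j = (\<Sum>k<j. N * r k / 8 + a k / (8 * N))" for j
  have N: "0 < N" using L by linarith
  have \<delta>: "0 \<le> \<delta>" using L by (simp add: \<delta>_def)
  have c: "0 < c" "c * \<gamma> = 9 / (8 * N)" "c * (L\<^sup>2 / \<gamma>) = N / 8" "c * (\<gamma>\<^sup>2 * \<sigma>\<^sup>2) = \<delta>"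
    using L N by (simp_all add: c_def \<gamma> \<delta>_def field_simps power2_eq_square)
  \<comment> \<open>The error recursion stops at \<open>K - 1\<close>; the last iteration is added separately below.\<close>
  have inv: "F j + c * a j + S j \<le> F 0 + c * a 0 + real j * \<delta>" if "j < K" for j
    using that
  proof (induction j)
    case 0
    then show ?case by (simp add: S_def)
  next
    case (Suc j)
    have "c * a (Suc j) \<le> c * ((1 - \<gamma>) * a j + L\<^sup>2 / \<gamma> * r j + \<gamma>\<^sup>2 * \<sigma>\<^sup>2)"
      using err[OF Suc.prems] c(1) by (intro mult_left_mono) auto
    also have "\<dots> = c * a j - (c * \<gamma>) * a j + (c * (L\<^sup>2 / \<gamma>)) * r j + c * (\<gamma>\<^sup>2 * \<sigma>\<^sup>2)"
      by (simp only: distrib_left left_diff_distrib right_diff_distrib mult_1 mult.assoc)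
    also have "\<dots> = c * a j - 9 / (8 * N) * a j + N / 8 * r j + \<delta>"
      by (simp only: c)
    finally have "c * a (Suc j) \<le> c * a j - 9 / (8 * N) * a j + N / 8 * r j + \<delta>" .
    moreover have "F (Suc j) + N / 4 * r j \<le> F j + a j / N" using dec Suc.prems by simp
    moreover have "9 / (8 * N) * a j = a j / N + a j / (8 * N)" using N by (simp add: field_simps)
    moreover have "S (Suc j) = S j + N * r j / 8 + a j / (8 * N)" by (simp add: S_def)
    ultimately have "F (Suc j) + c * a (Suc j) + S (Suc j) \<le> F j + c * a j + S j + \<delta>" by argo
    with Suc show ?case by (simp add: algebra_simps)
  qed
  have "S K \<le> F 0 + c * a 0 + real K * \<delta>"
  proof (cases K)
    case 0
    then show ?thesis using nonneg c(1) by (simp add: S_def)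
  next
    case (Suc j)
    have "S K = S j + N * r j / 8 + a j / (8 * N)" by (simp add: S_def Suc)
    moreover have "F K + N / 4 * r j \<le> F j + a j / N" using dec[of j] Suc by simp
    moreover have "9 / (8 * N) * a j = a j / N + a j / (8 * N)" using N by (simp add: field_simps)
    \<comment> \<open>In the last iteration the whole error term of the potential is given up.\<close>
    moreover have "9 / (8 * N) * a j \<le> c * a j"
      using L N nonneg(2)[of j] by (intro mult_right_mono) (simp_all add: c_def field_simps)
    moreover have "0 \<le> N * r j" using N nonneg(3)[of j] by simp
    moreover have "F j + c * a j + S j \<le> F 0 + c * a 0 + real j * \<delta>" using inv[of j] Suc by simp
    moreover have "real j * \<delta> \<le> real K * \<delta>" using Suc \<delta> by (intro mult_right_mono) auto
    ultimately show ?thesis using nonneg(1)[of K] by argo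
  qed
  moreover have "(\<Sum>k<K. N\<^sup>2 * r k + a k) = 8 * N * S K"
    unfolding S_def sum_distrib_left
    using N by (intro sum.cong refl) (simp add: field_simps power2_eq_square)
  ultimately show ?thesis using N unfolding c_def \<delta>_def by simp
qed

text \<open>
  With \<open>p = 3\<^sup>3\<^sup>/\<^sup>2/2\<close> and \<open>s = sqrt(KL\<sigma>\<^sup>2/\<Phi>)\<close> one has \<open>N = 3L + p s\<close>.  Because \<open>p\<^sup>2 = 27/4\<close>, the
  accumulated noise equals \<open>(p s)\<^sup>2 \<Phi>/(2N\<^sup>2)\<close>, and \<open>N \<ge> p s\<close> bounds its product with \<open>N\<close> by \<open>p s \<Phi>/2\<close>.
  What is left is \<open>96 L\<Phi> + 48 p s\<Phi>\<close>, where \<open>(s\<Phi>)\<^sup>2 = K L\<Phi>\<sigma>\<^sup>2\<close>.  Each half of the lower bound on \<open>K\<close>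
  controls one of these terms; \<open>22500 = 150\<^sup>2\<close> makes their sum at most \<open>K \<epsilon>\<close>.
\<close>
lemma step_coeff_average_bound:
  assumes L: "0 < L" and \<Phi>: "0 < \<Phi>" and \<epsilon>: "0 < \<epsilon>"
    and N: "N = step_coeff L \<sigma> \<Phi> K - L"
    and K: "22500 * (L * \<Phi> * \<sigma>\<^sup>2 / \<epsilon>\<^sup>2 + L * \<Phi> / \<epsilon>) \<le> real K"
  shows "32 * N * (\<Phi> + real K * (27 * L * \<sigma>\<^sup>2 / (8 * N\<^sup>2))) \<le> real K * \<epsilon>"
proof -
  define p s where "p = 3 powr (3 / 2) / (2::real)" and "s = sqrt (real K * L * \<sigma>\<^sup>2 / \<Phi>)"
  have "0 < L * \<Phi> / \<epsilon>" using assms by simp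
  moreover have "0 \<le> L * \<Phi> * \<sigma>\<^sup>2 / \<epsilon>\<^sup>2" using assms by simp
  ultimately have K0: "0 < real K" using K by argo
  have Npos: "N = 3 * L + p * s" by (simp add: N step_coeff_def p_def s_def)
  have s: "0 \<le> s" "s\<^sup>2 = real K * L * \<sigma>\<^sup>2 / \<Phi>" using assms by (simp_all add: s_def)
  have p0: "0 \<le> p" by (simp add: p_def)
  have "(3 powr (3 / 2))\<^sup>2 = (27::real)"
    by (subst powr_power) (simp_all add: powr_numeral)
  then have p2: "p\<^sup>2 = 27 / 4" by (simp add: p_def power_divide)
  have p: "p \<le> 2.6"
    by (rule power2_le_imp_le) (simp_all add: p2, simp add: power2_eq_square)
  have N0: "0 < N" using L p0 s by (simp add: Npos add_pos_nonneg)
  define X where "X = real K * (27 * L * \<sigma>\<^sup>2 / (8 * N\<^sup>2))"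
  have "X * N = (p * s) * (p * s) * \<Phi> / (2 * N)"
  proof -
    have "real K * L * \<sigma>\<^sup>2 = s\<^sup>2 * \<Phi>" using s(2) \<Phi> by simp
    then have "X * N = p\<^sup>2 * (s\<^sup>2 * \<Phi>) / (2 * N)"
      using N0 p2 by (simp add: X_def field_simps power2_eq_square)
    then show ?thesis by (simp add: power2_eq_square mult_ac)
  qed
  also have "\<dots> \<le> (p * s) * N * \<Phi> / (2 * N)"
    using N0 p0 s L \<Phi> by (intro divide_right_mono mult_right_mono mult_left_mono) (auto simp: Npos)
  also have "\<dots> = p * s * \<Phi> / 2" using N0 by simp
  finally have "32 * N * (\<Phi> + X) \<le> 32 * (N * \<Phi> + p * s * \<Phi> / 2)"
    by (simp add: algebra_simps)
  also have "\<dots> = 96 * (L * \<Phi>) + 48 * p * (s * \<Phi>)" by (simp add: Npos algebra_simps)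
  also have "\<dots> \<le> 96 * (real K * \<epsilon> / 22500) + 48 * 2.6 * (real K * \<epsilon> / 150)"
  proof (intro add_mono mult_left_mono mult_mono)
    have "22500 * (L * \<Phi> / \<epsilon>) \<le> real K" using K \<open>0 \<le> L * \<Phi> * \<sigma>\<^sup>2 / \<epsilon>\<^sup>2\<close> by argo
    then show "L * \<Phi> \<le> real K * \<epsilon> / 22500" using \<epsilon> by (simp add: field_simps)
    have "22500 * (L * \<Phi> * \<sigma>\<^sup>2 / \<epsilon>\<^sup>2) \<le> real K" using K \<open>0 < L * \<Phi> / \<epsilon>\<close> by argo
    then have *: "L * \<Phi> * \<sigma>\<^sup>2 \<le> real K * \<epsilon>\<^sup>2 / 22500" using \<epsilon> by (simp add: field_simps)
    have "(s * \<Phi>)\<^sup>2 = real K * (L * \<Phi> * \<sigma>\<^sup>2)"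
      using \<Phi> by (simp add: power_mult_distrib s(2)) (simp add: power2_eq_square)
    also have "\<dots> \<le> real K * (real K * \<epsilon>\<^sup>2 / 22500)" using * by (intro mult_left_mono) auto
    also have "\<dots> = (real K * \<epsilon> / 150)\<^sup>2" by (simp add: power2_eq_square)
    finally show "s * \<Phi> \<le> real K * \<epsilon> / 150"
      by (rule power2_le_imp_le) (use \<epsilon> in simp)
  qed (use p p0 s \<Phi> in auto)
  also have "\<dots> \<le> real K * \<epsilon>" using \<epsilon> K0 by simp
  finally show ?thesis unfolding X_def .
qed

section \<open>One run of the method\<close>

text \<open>
  A run with constant coefficients.  The lower bound on \<open>M\<close> is what makes \<open>\<gamma>\<close> a convex weight.
\<close>
locale prox_momentum_run = prob_space \<Omega>
  for \<Omega> :: "'w measure" +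
  fixes D :: "'s measure" and G :: "'a::euclidean_space \<Rightarrow> 's \<Rightarrow> 'a" and f \<psi> :: "'a \<Rightarrow> real"
    and L \<sigma> Fstar M \<gamma>i \<gamma> :: real and x0 :: 'a and mi g0 :: "'w \<Rightarrow> 'a"
    and K :: nat and \<xi> :: "nat \<Rightarrow> 'w \<Rightarrow> 's" and x :: "nat \<Rightarrow> 'w \<Rightarrow> 'a"
  assumes problem: "composite_problem L \<sigma> Fstar f \<psi> D G"
    and run: "exact_prox_run \<Omega> D G \<psi> (\<lambda>_. M) \<gamma>i (\<lambda>_. \<gamma>) x0 mi g0 K \<xi> x"
    and M: "4 * L \<le> M" and \<gamma>: "\<gamma> = 3 * L / (M - L)"
    and mi: "mi \<in> borel_measurable \<Omega>" and g0: "g0 \<in> borel_measurable \<Omega>"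
    and init: "init_error_integrable \<Omega> f x0 (init_momentum \<gamma>i mi g0)"
begin

lemmas problem_facts = composite_problemD[OF problem]

definition m where "m = momentum \<gamma>i (\<lambda>_. \<gamma>) mi (stoch_grad G g0 \<xi> x)"
definition gap where "gap k \<omega> = f (x k \<omega>) + \<psi> (x k \<omega>) - Fstar"
definition err where "err k \<omega> = (norm (m k \<omega> - gradient f (x k \<omega>)))\<^sup>2"
definition move where "move k \<omega> = (norm (x (Suc k) \<omega> - x k \<omega>))\<^sup>2"

lemma nonneg: "0 \<le> gap k \<omega>" "0 \<le> err k \<omega>" "0 \<le> move k \<omega>"
  using problem_facts(5)[of "x k \<omega>"] by (simp_all add: gap_def err_def move_def)

lemma \<gamma>_bounds: "0 < \<gamma>" "\<gamma> \<le> 1"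
  using problem_facts(1) M by (auto simp: \<gamma> field_simps)

lemma m_0: "m 0 = init_momentum \<gamma>i mi g0"
  by (simp add: m_def init_momentum_def fun_eq_iff)

lemma m_Suc: "m (Suc k) \<omega> = (1 - \<gamma>) *\<^sub>R m k \<omega> + \<gamma> *\<^sub>R G (x (Suc k) \<omega>) (\<xi> (Suc k) \<omega>)"
  by (simp add: m_def)

lemma x_0: "\<omega> \<in> space \<Omega> \<Longrightarrow> x 0 \<omega> = x0"
  using run by (simp add: exact_prox_run_def Let_def)

lemma x_measurable: "k \<le> K \<Longrightarrow> x k \<in> borel_measurable \<Omega>"
  using run by (simp add: exact_prox_run_def Let_def)

lemma sample_law:
  assumes "Suc k < K"
  shows "\<xi> (Suc k) \<in> measurable \<Omega> D" "distr \<Omega> D (\<xi> (Suc k)) = D"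
  using run assms by (simp_all add: exact_prox_run_def Let_def has_law_def)

lemma sample_indep:
  "Suc k < K \<Longrightarrow> indep_rv \<Omega> D (\<xi> (Suc k))
     (Pi\<^sub>M {..Suc k} (\<lambda>_. borel) \<Otimes>\<^sub>M (borel \<Otimes>\<^sub>M Pi\<^sub>M {..k} (\<lambda>_. borel)))
     (\<lambda>\<omega>. (\<lambda>i\<in>{..Suc k}. x i \<omega>, mi \<omega>, \<lambda>i\<in>{..k}. m i \<omega>))"
  using run by (simp add: exact_prox_run_def Let_def m_def)

lemma prox_step:
  "k < K \<Longrightarrow> AE \<omega> in \<Omega>.
     prox_model \<psi> (m k \<omega>) M (x k \<omega>) (x (Suc k) \<omega>) \<le> prox_model \<psi> (m k \<omega>) M (x k \<omega>) (x k \<omega>) \<and>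
     gradient (prox_model \<psi> (m k \<omega>) M (x k \<omega>)) (x (Suc k) \<omega>) = 0"
  using run by (simp add: exact_prox_run_def Let_def m_def)

lemma gradient_measurable [measurable]: "gradient f \<in> borel_measurable borel"
  using continuous_on_gradient[OF problem_facts(6,1)] by (rule borel_measurable_continuous_onI)

lemma m_measurable: "k < K \<Longrightarrow> m k \<in> borel_measurable \<Omega>"
proof (induction k)
  case 0
  then show ?case using mi g0 unfolding m_0 init_momentum_def[abs_def] by measurable
next
  case (Suc k)
  have [measurable]: "m k \<in> borel_measurable \<Omega>" "x (Suc k) \<in> borel_measurable \<Omega>"
    "\<xi> (Suc k) \<in> measurable \<Omega> D"
    using Suc x_measurable sample_law by auto
  have "(\<lambda>\<omega>. case (x (Suc k) \<omega>, \<xi> (Suc k) \<omega>) of (x, s) \<Rightarrow> G x s) \<in> borel_measurable \<Omega>"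
    by (rule measurable_compose[OF _ problem_facts(8)]) measurable
  then show ?case unfolding m_Suc[abs_def] by simp
qed

lemma quantities_measurable:
  "k \<le> K \<Longrightarrow> gap k \<in> borel_measurable \<Omega>"
  "k < K \<Longrightarrow> err k \<in> borel_measurable \<Omega>"
  "k < K \<Longrightarrow> move k \<in> borel_measurable \<Omega>"
proof -
  have [measurable]: "f \<in> borel_measurable borel" "\<psi> \<in> borel_measurable borel"
    using problem_facts(3,4) by (auto intro!: borel_measurable_continuous_onI differentiable_imp_continuous_on)
  show "gap k \<in> borel_measurable \<Omega>" if "k \<le> K"
    using x_measurable[OF that] unfolding gap_def[abs_def] by measurable
  show "err k \<in> borel_measurable \<Omega>" if "k < K"
    using x_measurable[of k] m_measurable[of k] that unfolding err_def[abs_def] by simp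
  show "move k \<in> borel_measurable \<Omega>" if "k < K"
    using x_measurable[of k] x_measurable[of "Suc k"] that unfolding move_def[abs_def] by simp
qed

definition Egap where "Egap k = (\<integral>\<^sup>+\<omega>. ennreal (gap k \<omega>) \<partial>\<Omega>)"
definition Eerr where "Eerr k = (\<integral>\<^sup>+\<omega>. ennreal (err k \<omega>) \<partial>\<Omega>)"
definition Emove where "Emove k = (\<integral>\<^sup>+\<omega>. ennreal (move k \<omega>) \<partial>\<Omega>)"

lemma N_pos: "0 < M - L" "3 * L \<le> M - L"
  using M problem_facts(1) by auto

lemma expected_decrease:
  assumes k: "k < K"
  shows "Egap (Suc k) + ennreal ((M - L) / 4) * Emove k \<le> Egap k + ennreal (1 / (M - L)) * Eerr k"
proof -
  note meas = quantities_measurable(1)[of k] quantities_measurable(1)[of "Suc k"]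
    quantities_measurable(2,3)[OF k]
  have "AE \<omega> in \<Omega>. ennreal (gap (Suc k) \<omega>) + ennreal ((M - L) / 4) * ennreal (move k \<omega>)
      \<le> ennreal (gap k \<omega>) + ennreal (1 / (M - L)) * ennreal (err k \<omega>)"
    using prox_step[OF k]
  proof eventually_elim
    case (elim \<omega>)
    then have "gap (Suc k) \<omega> + (M - L) / 4 * move k \<omega> \<le> gap k \<omega> + 1 / (M - L) * err k \<omega>"
      using prox_step_decrease[OF problem_facts(3,6), of M \<psi> "m k \<omega>" "x k \<omega>" "x (Suc k) \<omega>"] N_pos
      by (simp add: gap_def move_def err_def)
    then show ?case
      using nonneg N_pos by (simp add: ennreal_mult'[symmetric] ennreal_plus[symmetric] del: ennreal_plus)
  qed
  from nn_integral_mono_AE[OF this] show ?thesis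
    using meas k unfolding Egap_def Eerr_def Emove_def
    by (simp add: nn_integral_add nn_integral_cmult)
qed

text \<open>
  The new error is \<open>(1 - \<gamma>)(m\<^sub>k - \<nabla>f(x\<^sub>k\<^sub>+\<^sub>1))\<close> plus \<open>\<gamma>\<close> times the noise of the fresh sample.  Averaging over
  that sample, with the past fixed, adds at most \<open>\<gamma>\<^sup>2\<sigma>\<^sup>2\<close>.  The first part is the old error plus the
  drift of the gradient; Young's inequality with weight \<open>\<gamma>/(1 - \<gamma>)\<close> turns the factor \<open>(1 - \<gamma>)\<^sup>2\<close> of
  the old error into \<open>1 - \<gamma>\<close>.
\<close>
lemma expected_error_recursion:
  assumes k: "Suc k < K"
  shows "Eerr (Suc k) \<le> ennreal (1 - \<gamma>) * Eerr k + ennreal (L\<^sup>2 / \<gamma>) * Emove k + ennreal (\<gamma>\<^sup>2 * \<sigma>\<^sup>2)"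
proof -
  define h where "h s u v = ennreal ((norm ((1 - \<gamma>) *\<^sub>R (v - gradient f u) + \<gamma> *\<^sub>R (G u s - gradient f u)))\<^sup>2)"
    for s u v
  let ?T = "Pi\<^sub>M {..Suc k} (\<lambda>_. borel) \<Otimes>\<^sub>M (borel \<Otimes>\<^sub>M Pi\<^sub>M {..k} (\<lambda>_. borel)) :: ((nat \<Rightarrow> 'a) \<times> 'a \<times> (nat \<Rightarrow> 'a)) measure"
  let ?Y = "\<lambda>\<omega>. (\<lambda>i\<in>{..Suc k}. x i \<omega>, mi \<omega>, \<lambda>i\<in>{..k}. m i \<omega>)"
  let ?h = "\<lambda>p. h (fst p) (fst (snd p) (Suc k)) (snd (snd (snd p)) k)"
  have [measurable]: "(\<lambda>p. fst (snd p) (Suc k)) \<in> borel_measurable (D \<Otimes>\<^sub>M ?T)"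
    by (rule measurable_compose[OF _ measurable_component_singleton[of "Suc k" "{..Suc k}"]]) auto
  have [measurable]: "(\<lambda>p. snd (snd (snd p)) k) \<in> borel_measurable (D \<Otimes>\<^sub>M ?T)"
    by (rule measurable_compose[OF _ measurable_component_singleton[of "k" "{..k}"]]) auto
  have "(\<lambda>p. case (fst (snd p) (Suc k), fst p) of (x, s) \<Rightarrow> G x s) \<in> borel_measurable (D \<Otimes>\<^sub>M ?T)"
    by (rule measurable_compose[OF _ problem_facts(8)]) measurable
  then have h: "?h \<in> borel_measurable (D \<Otimes>\<^sub>M ?T)" unfolding h_def by simp
  have "Eerr (Suc k) = (\<integral>\<^sup>+\<omega>. ?h (\<xi> (Suc k) \<omega>, ?Y \<omega>) \<partial>\<Omega>)"
    unfolding Eerr_def err_def h_def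
    by (intro nn_integral_cong) (simp add: m_Suc algebra_simps)
  also have "\<dots> = (\<integral>\<^sup>+\<omega>. (\<integral>\<^sup>+s. ?h (s, ?Y \<omega>) \<partial>D) \<partial>\<Omega>)"
    using nn_integral_indep_rv[OF prob_space_axioms sample_indep[OF k] h] sample_law(2)[OF k] by simp
  also have "\<dots> \<le> (\<integral>\<^sup>+\<omega>. ennreal (1 - \<gamma>) * ennreal (err k \<omega>) + ennreal (L\<^sup>2 / \<gamma>) * ennreal (move k \<omega>)
      + ennreal (\<gamma>\<^sup>2 * \<sigma>\<^sup>2) \<partial>\<Omega>)"
  proof (rule nn_integral_mono)
    fix \<omega>
    let ?a = "(1 - \<gamma>) *\<^sub>R (m k \<omega> - gradient f (x (Suc k) \<omega>))"
    have "(norm ?a)\<^sup>2 \<le> (1 - \<gamma>) * err k \<omega> + L\<^sup>2 / \<gamma> * move k \<omega>"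
    \<comment> \<open>For \<open>\<gamma> = 1\<close> (that is, \<open>M = 4L\<close>) the Young weight would be infinite, but the left-hand side is 0.\<close>
    proof (cases "\<gamma> = 1")
      case True
      then show ?thesis using nonneg by simp
    next
      case False
      then have \<gamma>1: "0 < \<gamma>" "\<gamma> < 1" using \<gamma>_bounds by auto
      let ?b = "gradient f (x k \<omega>) - gradient f (x (Suc k) \<omega>)"
      have "(norm ?b)\<^sup>2 \<le> (L * norm (x (Suc k) \<omega> - x k \<omega>))\<^sup>2"
        using problem_facts(6) unfolding L_smooth_def norm_minus_commute[of "x (Suc k) \<omega>"]
        by (intro power_mono) auto
      then have b: "(norm ?b)\<^sup>2 \<le> L\<^sup>2 * move k \<omega>" by (simp add: move_def power_mult_distrib)
      have "(norm ?a)\<^sup>2 = (1 - \<gamma>)\<^sup>2 * (norm ((m k \<omega> - gradient f (x k \<omega>)) + ?b))\<^sup>2"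
        by (simp add: power_mult_distrib)
      also have "\<dots> \<le> (1 - \<gamma>)\<^sup>2 * ((1 + \<gamma> / (1 - \<gamma>)) * err k \<omega> + (1 + 1 / (\<gamma> / (1 - \<gamma>))) * (norm ?b)\<^sup>2)"
        unfolding err_def using \<gamma>1 by (intro mult_left_mono young_norm) auto
      also have "\<dots> = (1 - \<gamma>) * err k \<omega> + (1 - \<gamma>)\<^sup>2 / \<gamma> * (norm ?b)\<^sup>2"
        using \<gamma>1 by (simp add: field_simps power2_eq_square)
      also have "\<dots> \<le> (1 - \<gamma>) * err k \<omega> + 1 / \<gamma> * (L\<^sup>2 * move k \<omega>)"
        using \<gamma>1 b by (intro add_left_mono mult_mono divide_right_mono) (auto simp: power_le_one)
      finally show ?thesis by simp
    qed
    then have le: "(norm ?a)\<^sup>2 + \<gamma>\<^sup>2 * \<sigma>\<^sup>2 \<le> (1 - \<gamma>) * err k \<omega> + L\<^sup>2 / \<gamma> * move k \<omega> + \<gamma>\<^sup>2 * \<sigma>\<^sup>2" by simp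
    have "(\<integral>\<^sup>+s. ?h (s, ?Y \<omega>) \<partial>D) \<le> ennreal ((norm ?a)\<^sup>2 + \<gamma>\<^sup>2 * \<sigma>\<^sup>2)"
      unfolding h_def using oracle_perturbation_moment[OF problem, of ?a \<gamma> "x (Suc k) \<omega>"] by simp
    also have "\<dots> \<le> ennreal ((1 - \<gamma>) * err k \<omega> + L\<^sup>2 / \<gamma> * move k \<omega> + \<gamma>\<^sup>2 * \<sigma>\<^sup>2)"
      using le by (rule ennreal_leI)
    also have "\<dots> = ennreal (1 - \<gamma>) * ennreal (err k \<omega>) + ennreal (L\<^sup>2 / \<gamma>) * ennreal (move k \<omega>)
      + ennreal (\<gamma>\<^sup>2 * \<sigma>\<^sup>2)"
      using nonneg \<gamma>_bounds by (simp add: ennreal_mult'[symmetric])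
    finally show "(\<integral>\<^sup>+s. ?h (s, ?Y \<omega>) \<partial>D) \<le> \<dots>" .
  qed
  also have "\<dots> = ennreal (1 - \<gamma>) * Eerr k + ennreal (L\<^sup>2 / \<gamma>) * Emove k + ennreal (\<gamma>\<^sup>2 * \<sigma>\<^sup>2)"
    using quantities_measurable(2,3)[of k] k unfolding Eerr_def Emove_def
    by (simp add: nn_integral_add nn_integral_cmult emeasure_space_1)
  finally show ?thesis .
qed

lemma initial_values:
  "Egap 0 = ennreal (f x0 + \<psi> x0 - Fstar)"
  "Eerr 0 = ennreal (\<integral>\<omega>. (norm (init_momentum \<gamma>i mi g0 \<omega> - gradient f x0))\<^sup>2 \<partial>\<Omega>)"
proof -
  have "Egap 0 = (\<integral>\<^sup>+\<omega>. ennreal (f x0 + \<psi> x0 - Fstar) \<partial>\<Omega>)"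
    unfolding Egap_def by (intro nn_integral_cong) (simp add: gap_def x_0)
  then show "Egap 0 = ennreal (f x0 + \<psi> x0 - Fstar)" by (simp add: emeasure_space_1)
  have "Eerr 0 = (\<integral>\<^sup>+\<omega>. ennreal ((norm (init_momentum \<gamma>i mi g0 \<omega> - gradient f x0))\<^sup>2) \<partial>\<Omega>)"
    unfolding Eerr_def by (intro nn_integral_cong) (simp add: err_def x_0 m_0)
  also have "\<dots> = ennreal (\<integral>\<omega>. (norm (init_momentum \<gamma>i mi g0 \<omega> - gradient f x0))\<^sup>2 \<partial>\<Omega>)"
    using init by (intro nn_integral_eq_integral) (auto simp: init_error_integrable_def)
  finally show "Eerr 0 = \<dots>" .
qed

text \<open>
  The two recursions live in the extended nonnegative reals.  Finiteness, which is needed for the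
  subtractions in the telescoping argument, propagates along the run from the initial error.
\<close>
lemma finite_step:
  assumes k: "k < K" and fin: "Egap k < \<infinity>" "Eerr k < \<infinity>"
  shows "Egap (Suc k) < \<infinity>" "Emove k < \<infinity>"
proof -
  have "Egap (Suc k) + ennreal ((M - L) / 4) * Emove k < \<infinity>"
    using fin by (intro le_less_trans[OF expected_decrease[OF k]]) (simp add: ennreal_mult_less_top)
  then show "Egap (Suc k) < \<infinity>" "Emove k < \<infinity>"
    using N_pos by (auto simp: ennreal_mult_less_top)
qed

lemma finite_expectations:
  assumes "k < K"
  shows "Egap k < \<infinity>" "Eerr k < \<infinity>"
proof -
  have "Egap k < \<infinity> \<and> Eerr k < \<infinity>"
    using assms
  proof (induction k)
    case 0
    then show ?case by (simp add: initial_values)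
  next
    case (Suc k)
    then have IH: "Egap k < \<infinity>" "Eerr k < \<infinity>" by auto
    have "Eerr (Suc k) < \<infinity>"
      using IH finite_step[OF _ IH] Suc.prems
      by (intro le_less_trans[OF expected_error_recursion]) (simp_all add: ennreal_mult_less_top)
    then show ?case using finite_step[OF _ IH] Suc.prems by simp
  qed
  then show "Egap k < \<infinity>" "Eerr k < \<infinity>" by auto
qed

text \<open>
  Estimate (b) holds pathwise; its expectation is summed over the iterations and bounded by
  telescoping.
\<close>
lemma expected_gradient_bound:
  assumes K: "1 \<le> K"
  shows "expected_sq_grad \<Omega> (\<lambda>y. f y + \<psi> y) K x
     \<le> ennreal (32 * (M - L) * (init_potential \<Omega> L Fstar f \<psi> x0 (init_momentum \<gamma>i mi g0)
           + real K * (27 * L * \<sigma>\<^sup>2 / (8 * (M - L)\<^sup>2))) / real K)"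
proof -
  let ?N = "M - L" and ?\<Phi> = "init_potential \<Omega> L Fstar f \<psi> x0 (init_momentum \<gamma>i mi g0)"
  define F a r where "F k = enn2real (Egap k)" and "a k = enn2real (Eerr k)"
    and "r k = enn2real (Emove k)" for k
  have F: "Egap k = ennreal (F k)" if "k \<le> K" for k
  proof (cases k)
    case (Suc j)
    then show ?thesis using finite_step(1)[OF _ finite_expectations] that by (simp add: F_def)
  qed (simp add: F_def initial_values)
  have a: "Eerr k = ennreal (a k)" if "k < K" for k
    using finite_expectations(2)[OF that] by (simp add: a_def)
  have r: "Emove k = ennreal (r k)" if "k < K" for k
    using finite_step(2)[OF that finite_expectations[OF that]] by (simp add: r_def)
  have nn: "0 \<le> F k" "0 \<le> a k" "0 \<le> r k" for k by (simp_all add: F_def a_def r_def)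
  have sum_bound: "(\<Sum>k<K. ?N\<^sup>2 * r k + a k)
      \<le> 8 * ?N * (F 0 + 3 / (8 * L) * a 0 + real K * (27 * L * \<sigma>\<^sup>2 / (8 * ?N\<^sup>2)))"
  proof (rule momentum_telescope[OF problem_facts(1) N_pos(2) \<gamma>])
    fix k assume k: "k < K"
    have "ennreal (F (Suc k) + ?N / 4 * r k) \<le> ennreal (F k + a k / ?N)"
      using expected_decrease[OF k] F[of k] F[of "Suc k"] a[OF k] r[OF k] k N_pos nn
      by (simp add: ennreal_mult'[symmetric] ennreal_plus[symmetric] del: ennreal_plus)
    then show "F (Suc k) + ?N / 4 * r k \<le> F k + a k / ?N"
      using nn N_pos by (subst (asm) ennreal_le_iff) auto
  next
    fix k assume k: "Suc k < K"
    have "ennreal (a (Suc k)) \<le> ennreal ((1 - \<gamma>) * a k + L\<^sup>2 / \<gamma> * r k + \<gamma>\<^sup>2 * \<sigma>\<^sup>2)"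
      using expected_error_recursion[OF k] a[OF k] a[of k] r[of k] k \<gamma>_bounds nn
      by (simp add: ennreal_mult'[symmetric] ennreal_plus[symmetric] del: ennreal_plus)
    then show "a (Suc k) \<le> (1 - \<gamma>) * a k + L\<^sup>2 / \<gamma> * r k + \<gamma>\<^sup>2 * \<sigma>\<^sup>2"
      using nn \<gamma>_bounds by (subst (asm) ennreal_le_iff) auto
  qed (rule nn)+
  have \<Phi>: "?\<Phi> = F 0 + 3 / (8 * L) * a 0"
    using problem_facts(5)[of x0] by (simp add: init_potential_def F_def a_def initial_values)
  define v where "v t \<omega> = ennreal (4 * (?N\<^sup>2 * move (t - 1) \<omega> + err (t - 1) \<omega>))" for t \<omega>
  have "expected_sq_grad \<Omega> (\<lambda>y. f y + \<psi> y) K x \<le> (\<Sum>t\<in>{1..K}. \<integral>\<^sup>+\<omega>. v t \<omega> \<partial>\<Omega>) / of_nat K"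
    unfolding expected_sq_grad_def
  proof (rule nn_integral_uniform_index_le[OF prob_space_axioms K])
    fix t assume t: "t \<in> {1..K}"
    then show "v t \<in> borel_measurable \<Omega>"
    proof -
      have [measurable]: "err (t - 1) \<in> borel_measurable \<Omega>" "move (t - 1) \<in> borel_measurable \<Omega>"
        using quantities_measurable(2,3)[of "t - 1"] t by auto
      show ?thesis unfolding v_def by measurable
    qed
    have t': "t - 1 < K" "Suc (t - 1) = t" using t by auto
    show "AE \<omega> in \<Omega>. ennreal ((norm (gradient (\<lambda>y. f y + \<psi> y) (x t \<omega>)))\<^sup>2) \<le> v t \<omega>"
      using prox_step[OF t'(1)] unfolding t'(2)
    proof eventually_elim
      case (elim \<omega>)
      then show ?case
        using prox_step_gradient_bound[OF problem_facts(3,4,6,1) M, of "m (t - 1) \<omega>" "x (t - 1) \<omega>" "x t \<omega>"]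
        unfolding v_def move_def err_def t'(2) by (intro ennreal_leI) simp
    qed
  qed
  also have "(\<Sum>t\<in>{1..K}. \<integral>\<^sup>+\<omega>. v t \<omega> \<partial>\<Omega>) = (\<Sum>k<K. \<integral>\<^sup>+\<omega>. v (Suc k) \<omega> \<partial>\<Omega>)"
    by (simp add: sum.atLeast1_atMost_eq)
  also have "\<dots> = (\<Sum>k<K. ennreal (4 * (?N\<^sup>2 * r k + a k)))"
  proof (intro sum.cong refl)
    fix k assume "k \<in> {..<K}"
    then have k: "k < K" by simp
    have "(\<integral>\<^sup>+\<omega>. v (Suc k) \<omega> \<partial>\<Omega>)
        = (\<integral>\<^sup>+\<omega>. ennreal (4 * ?N\<^sup>2) * ennreal (move k \<omega>) + ennreal 4 * ennreal (err k \<omega>) \<partial>\<Omega>)"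
      unfolding v_def using nonneg
      by (intro nn_integral_cong) (simp add: ennreal_mult'[symmetric] ennreal_plus[symmetric] algebra_simps
          del: ennreal_plus ennreal_numeral)
    also have "\<dots> = ennreal (4 * ?N\<^sup>2) * Emove k + ennreal 4 * Eerr k"
      using quantities_measurable(2,3)[OF k] unfolding Emove_def Eerr_def
      by (simp add: nn_integral_add nn_integral_cmult)
    also have "\<dots> = ennreal (4 * (?N\<^sup>2 * r k + a k))"
      using nn by (simp only: a[OF k] r[OF k])
        (simp add: ennreal_mult'[symmetric] ennreal_plus[symmetric] algebra_simps
          del: ennreal_plus ennreal_numeral)
    finally show "(\<integral>\<^sup>+\<omega>. v (Suc k) \<omega> \<partial>\<Omega>) = \<dots>" .
  qed
  also have "\<dots> = ennreal (4 * (\<Sum>k<K. ?N\<^sup>2 * r k + a k))"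
    unfolding sum_distrib_left using nn by (intro sum_ennreal) simp
  also have "\<dots> / of_nat K = ennreal (4 * (\<Sum>k<K. ?N\<^sup>2 * r k + a k) / real K)"
    using K nn by (simp add: divide_ennreal ennreal_of_nat_eq_real_of_nat sum_nonneg)
  also have "\<dots> \<le> ennreal (32 * ?N * (F 0 + 3 / (8 * L) * a 0
      + real K * (27 * L * \<sigma>\<^sup>2 / (8 * ?N\<^sup>2))) / real K)"
    using mult_left_mono[OF sum_bound, of 4]
    by (intro ennreal_leI divide_right_mono) (simp_all only: mult.assoc[symmetric], simp_all)
  finally show ?thesis unfolding \<Phi> .
qed

end

text \<open>
  \<open>K\<close> is the least integer that meets the requirement of \<open>step_coeff_average_bound\<close>; it is positive
  because \<open>\<Phi>\<close> is.  The free quantity \<open>A\<close> stands for any bound on \<open>L\<Phi>\<close> up to constants, such as the bounds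
  that the different initializations provide.
\<close>
lemma iteration_count_reaches_accuracy:
  assumes prob: "composite_problem L \<sigma> Fstar f \<psi> D G" and \<epsilon>: "0 < \<epsilon>"
    and \<Omega>: "prob_space \<Omega>"
    and meas: "mi \<in> borel_measurable \<Omega>" "g0 \<in> borel_measurable \<Omega>"
    and init: "init_error_integrable \<Omega> f x0 (init_momentum \<gamma>i mi g0)"
    and \<Phi>: "\<Phi> = init_potential \<Omega> L Fstar f \<psi> x0 (init_momentum \<gamma>i mi g0)" "0 < \<Phi>"
    and A: "22500 * (L * \<Phi>) \<le> C * A"
  shows "\<exists>K. 1 \<le> K \<and> int K \<le> \<lceil>C * (A * \<sigma>\<^sup>2 / \<epsilon>\<^sup>2 + A / \<epsilon>)\<rceil> \<and> reaches_accuracy \<Omega> D G f \<psi> L \<sigma> Fstar \<epsilon> x0 \<gamma>i mi g0 K"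
proof -
  define b where "b = 22500 * (L * \<Phi> * \<sigma>\<^sup>2 / \<epsilon>\<^sup>2 + L * \<Phi> / \<epsilon>)"
  define K where "K = nat \<lceil>b\<rceil>"
  have L: "0 < L" using composite_problemD(1)[OF prob] .
  have "0 < L * \<Phi> / \<epsilon>" "0 \<le> L * \<Phi> * \<sigma>\<^sup>2 / \<epsilon>\<^sup>2" using L \<epsilon> \<Phi>(2) by simp_all
  then have b0: "0 < b" unfolding b_def by simp
  have K1: "1 \<le> K" unfolding K_def using b0 by linarith
  have bK: "b \<le> real K" unfolding K_def by (rule real_nat_ceiling_ge)
  have "b = 22500 * (L * \<Phi>) * (\<sigma>\<^sup>2 / \<epsilon>\<^sup>2 + 1 / \<epsilon>)" by (simp add: b_def algebra_simps)
  also have "\<dots> \<le> C * A * (\<sigma>\<^sup>2 / \<epsilon>\<^sup>2 + 1 / \<epsilon>)" using A \<epsilon> by (intro mult_right_mono) auto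
  also have "\<dots> = C * (A * \<sigma>\<^sup>2 / \<epsilon>\<^sup>2 + A / \<epsilon>)" by (simp add: algebra_simps)
  finally have "\<lceil>b\<rceil> \<le> \<lceil>C * (A * \<sigma>\<^sup>2 / \<epsilon>\<^sup>2 + A / \<epsilon>)\<rceil>" by (rule ceiling_mono)
  then have KB: "int K \<le> \<lceil>C * (A * \<sigma>\<^sup>2 / \<epsilon>\<^sup>2 + A / \<epsilon>)\<rceil>"
    unfolding K_def using b0 by linarith
  have "reaches_accuracy \<Omega> D G f \<psi> L \<sigma> Fstar \<epsilon> x0 \<gamma>i mi g0 K"
    unfolding reaches_accuracy_def Let_def \<Phi>(1)[symmetric]
  proof (intro allI impI)
    fix \<xi> x
    define M where "M = step_coeff L \<sigma> \<Phi> K"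
    assume "exact_prox_run \<Omega> D G \<psi> (\<lambda>_. step_coeff L \<sigma> \<Phi> K) \<gamma>i
      (\<lambda>_. 3 * L / (step_coeff L \<sigma> \<Phi> K - L)) x0 mi g0 K \<xi> x"
    moreover have "4 * L \<le> M"
      using L \<Phi>(2) by (simp add: M_def step_coeff_def)
    ultimately interpret prox_momentum_run \<Omega> D G f \<psi> L \<sigma> Fstar M \<gamma>i "3 * L / (M - L)" x0 mi g0 K \<xi> x
      using prob meas init \<Omega>
      by (simp add: prox_momentum_run_def prox_momentum_run_axioms_def M_def)
    have "expected_sq_grad \<Omega> (\<lambda>y. f y + \<psi> y) K x
        \<le> ennreal (32 * (M - L) * (\<Phi> + real K * (27 * L * \<sigma>\<^sup>2 / (8 * (M - L)\<^sup>2))) / real K)"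
      using expected_gradient_bound[OF K1] by (simp add: \<Phi>(1))
    also have "\<dots> \<le> ennreal \<epsilon>"
      using step_coeff_average_bound[OF L \<Phi>(2) \<epsilon> refl bK[unfolded b_def]] K1
      by (intro ennreal_leI) (simp add: M_def divide_le_eq mult.commute)
    finally show "expected_sq_grad \<Omega> (\<lambda>y. f y + \<psi> y) K x \<le> ennreal \<epsilon>" .
  qed
  with K1 KB show ?thesis by blast
qed

section \<open>Initial momentum\<close>

lemma sample_noise_moment:
  assumes prob: "composite_problem L \<sigma> Fstar f \<psi> D G" and law: "has_law \<Omega> D \<zeta>"
  shows "(\<lambda>\<omega>. G x (\<zeta> \<omega>)) \<in> borel_measurable \<Omega>"
    and "integrable \<Omega> (\<lambda>\<omega>. (norm (G x (\<zeta> \<omega>) - gradient f x))\<^sup>2)"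
    and "(\<integral>\<omega>. (norm (G x (\<zeta> \<omega>) - gradient f x))\<^sup>2 \<partial>\<Omega>) \<le> \<sigma>\<^sup>2"
    and "integrable \<Omega> (\<lambda>\<omega>. G x (\<zeta> \<omega>))" "(\<integral>\<omega>. G x (\<zeta> \<omega>) \<partial>\<Omega>) = gradient f x"
proof -
  note P = composite_problemD[OF prob] and N = oracle_noise_moment[OF prob, of x]
  have \<zeta>[measurable]: "\<zeta> \<in> measurable \<Omega> D" and D: "distr \<Omega> D \<zeta> = D"
    using law by (auto simp: has_law_def)
  have G[measurable]: "G x \<in> borel_measurable D" using P(9) by (rule borel_measurable_integrable)
  show "(\<lambda>\<omega>. G x (\<zeta> \<omega>)) \<in> borel_measurable \<Omega>" by measurable
  show "integrable \<Omega> (\<lambda>\<omega>. (norm (G x (\<zeta> \<omega>) - gradient f x))\<^sup>2)"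
    using integrable_distr[OF \<zeta>, of "\<lambda>s. (norm (G x s - gradient f x))\<^sup>2"] N(1) by (simp add: D)
  show "(\<integral>\<omega>. (norm (G x (\<zeta> \<omega>) - gradient f x))\<^sup>2 \<partial>\<Omega>) \<le> \<sigma>\<^sup>2"
    using integral_distr[OF \<zeta>, of "\<lambda>s. (norm (G x s - gradient f x))\<^sup>2"] N(2) by (simp add: D)
  show "integrable \<Omega> (\<lambda>\<omega>. G x (\<zeta> \<omega>))"
    using integrable_distr[OF \<zeta>, of "G x"] P(9) by (simp add: D)
  show "(\<integral>\<omega>. G x (\<zeta> \<omega>) \<partial>\<Omega>) = gradient f x"
    using integral_distr[OF \<zeta>, of "G x"] P(10) by (simp add: D)
qed

lemma minibatch_noise_moment:
  assumes prob: "composite_problem L \<sigma> Fstar f \<psi> D G" and \<Omega>: "prob_space \<Omega>" and b: "0 < b"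
    and law: "\<forall>i<b. has_law \<Omega> D (\<zeta> i)"
    and ind: "prob_space.indep_vars \<Omega> (\<lambda>_. D) \<zeta> {..<b}"
  shows "minibatch_gradient G x b \<zeta> \<in> borel_measurable \<Omega>"
    and "integrable \<Omega> (\<lambda>\<omega>. (norm (minibatch_gradient G x b \<zeta> \<omega> - gradient f x))\<^sup>2)"
    and "(\<integral>\<omega>. (norm (minibatch_gradient G x b \<zeta> \<omega> - gradient f x))\<^sup>2 \<partial>\<Omega>) \<le> \<sigma>\<^sup>2 / real b"
proof -
  interpret prob_space \<Omega> by fact
  note S = sample_noise_moment[OF prob law[rule_format], of _ x]
  define Y where "Y i \<omega> = G x (\<zeta> i \<omega>) - gradient f x" for i \<omega>
  have [measurable]: "G x \<in> borel_measurable D"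
    using composite_problemD(9)[OF prob] by (rule borel_measurable_integrable)
  have indY: "indep_vars (\<lambda>_. borel) Y {..<b}"
    unfolding Y_def[abs_def]
    by (rule indep_vars_compose2[OF ind, of "\<lambda>_ s. G x s - gradient f x"]) measurable
  have sq: "integrable \<Omega> (\<lambda>\<omega>. (norm (Y i \<omega>))\<^sup>2)"
    and var: "expectation (\<lambda>\<omega>. (norm (Y i \<omega>))\<^sup>2) \<le> \<sigma>\<^sup>2"
    and mean: "expectation (Y i) = 0" if "i \<in> {..<b}" for i
    using S[of i] that unfolding Y_def[abs_def] by (simp_all add: prob_space)
  note sum = second_moment_sum_indep[OF indY sq mean]
  have eq: "(norm (minibatch_gradient G x b \<zeta> \<omega> - gradient f x))\<^sup>2
      = (1 / real b)\<^sup>2 * (norm (\<Sum>i<b. Y i \<omega>))\<^sup>2" for \<omega>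
  proof -
    have "minibatch_gradient G x b \<zeta> \<omega> - gradient f x = (1 / real b) *\<^sub>R (\<Sum>i<b. Y i \<omega>)"
      using b by (simp add: minibatch_gradient_def Y_def sum_subtractf scaleR_diff_right
          sum_constant_scaleR)
    then show ?thesis by (simp add: power_divide)
  qed
  have "(\<lambda>\<omega>. \<Sum>i<b. G x (\<zeta> i \<omega>)) \<in> borel_measurable \<Omega>"
    using S(1) by (intro borel_measurable_sum) simp
  then show "minibatch_gradient G x b \<zeta> \<in> borel_measurable \<Omega>"
    unfolding minibatch_gradient_def[abs_def] by measurable
  show "integrable \<Omega> (\<lambda>\<omega>. (norm (minibatch_gradient G x b \<zeta> \<omega> - gradient f x))\<^sup>2)"
    unfolding eq using sum(1) by simp
  have "expectation (\<lambda>\<omega>. (norm (minibatch_gradient G x b \<zeta> \<omega> - gradient f x))\<^sup>2)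
      = (1 / real b)\<^sup>2 * (\<Sum>i<b. expectation (\<lambda>\<omega>. (norm (Y i \<omega>))\<^sup>2))"
    unfolding eq using sum(2) by simp
  also have "\<dots> \<le> (1 / real b)\<^sup>2 * (real b * \<sigma>\<^sup>2)"
    using sum_bounded_above[of "{..<b}" _ "\<sigma>\<^sup>2"] var by (intro mult_left_mono) auto
  also have "\<dots> = \<sigma>\<^sup>2 / real b" using b by (simp add: power2_eq_square)
  finally show "expectation (\<lambda>\<omega>. (norm (minibatch_gradient G x b \<zeta> \<omega> - gradient f x))\<^sup>2) \<le> \<sigma>\<^sup>2 / real b" .
qed

lemma init_momentum_gradient: "init_momentum \<gamma>i g0 g0 = g0"
  by (simp add: init_momentum_def fun_eq_iff scaleR_add_left[symmetric])

lemma init_momentum_zero: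
  "\<gamma>i \<noteq> 1 \<Longrightarrow> init_momentum \<gamma>i (\<lambda>\<omega>. (- \<gamma>i / (1 - \<gamma>i)) *\<^sub>R g0 \<omega>) g0 = (\<lambda>_. 0)"
  by (simp add: init_momentum_def fun_eq_iff)

text \<open>
  Starting from \<open>m\<^sub>0 = 0\<close> the initial error is \<open>\<parallel>\<nabla>f(x\<^sub>0)\<parallel>\<^sup>2 \<le> 2LF\<^sub>0\<close>, hence \<open>\<Phi>\<^sub>0 \<le> 7/4 F\<^sub>0\<close>, and
  \<open>7/4 \<cdot> 22500 \<le> 40000\<close>.
\<close>
lemma zero_init_complexity:
  assumes prob: "composite_problem L \<sigma> Fstar f \<psi> D G" and \<psi>: "\<And>x. \<psi> x = 0" and \<epsilon>: "0 < \<epsilon>"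
    and \<Omega>: "prob_space \<Omega>"
    and meas: "mi \<in> borel_measurable \<Omega>" "g0 \<in> borel_measurable \<Omega>"
    and m0: "init_momentum \<gamma>i mi g0 = (\<lambda>_. 0)"
    and F0: "F0 = f x0 + \<psi> x0 - Fstar"
  shows "init_error_integrable \<Omega> f x0 (init_momentum \<gamma>i mi g0)"
    and "0 < init_potential \<Omega> L Fstar f \<psi> x0 (init_momentum \<gamma>i mi g0) \<Longrightarrow>
      \<exists>K. 1 \<le> K \<and> int K \<le> \<lceil>40000 * (L * F0 * \<sigma>\<^sup>2 / \<epsilon>\<^sup>2 + L * F0 / \<epsilon>)\<rceil> \<and>
        reaches_accuracy \<Omega> D G f \<psi> L \<sigma> Fstar \<epsilon> x0 \<gamma>i mi g0 K"
proof -
  interpret prob_space \<Omega> by fact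
  note P = composite_problemD[OF prob]
  let ?\<Phi> = "init_potential \<Omega> L Fstar f \<psi> x0 (init_momentum \<gamma>i mi g0)"
  show init: "init_error_integrable \<Omega> f x0 (init_momentum \<gamma>i mi g0)"
    unfolding init_error_integrable_def m0 by simp
  have \<Phi>: "?\<Phi> = F0 + 3 / (8 * L) * (norm (gradient f x0))\<^sup>2"
    by (simp add: init_potential_def m0 F0 prob_space)
  have "(norm (gradient f x0))\<^sup>2 \<le> 2 * L * F0"
    using L_smooth_gradient_bound[OF P(3,6,1), of Fstar x0] P(5) \<psi> by (simp add: F0)
  then have "L * ?\<Phi> \<le> 7 / 4 * (L * F0)"
    unfolding \<Phi> using P(1) by (simp add: distrib_left mult_ac)
  moreover have "0 \<le> L * F0" using P(1,5) by (simp add: F0)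
  ultimately have "22500 * (L * ?\<Phi>) \<le> 40000 * (L * F0)" by argo
  then show "\<exists>K. 1 \<le> K \<and> int K \<le> \<lceil>40000 * (L * F0 * \<sigma>\<^sup>2 / \<epsilon>\<^sup>2 + L * F0 / \<epsilon>)\<rceil> \<and>
        reaches_accuracy \<Omega> D G f \<psi> L \<sigma> Fstar \<epsilon> x0 \<gamma>i mi g0 K" if "0 < ?\<Phi>"
    by (rule iteration_count_reaches_accuracy[OF prob \<epsilon> \<Omega> meas init refl that])
qed

text \<open>
  For \<open>m\<^sub>-\<^sub>1 = g\<^sub>0\<close> also \<open>m\<^sub>0 = g\<^sub>0\<close>, so the initial error is the variance of the first gradient estimate.
  The factor \<open>16/9\<close> is \<open>40000/22500\<close>.
\<close>
lemma gradient_init_complexity: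
  assumes prob: "composite_problem L \<sigma> Fstar f \<psi> D G" and \<epsilon>: "0 < \<epsilon>" and \<Omega>: "prob_space \<Omega>"
    and meas: "g0 \<in> borel_measurable \<Omega>"
    and int: "integrable \<Omega> (\<lambda>\<omega>. (norm (g0 \<omega> - gradient f x0))\<^sup>2)"
    and var: "(\<integral>\<omega>. (norm (g0 \<omega> - gradient f x0))\<^sup>2 \<partial>\<Omega>) \<le> V"
    and F0: "F0 = f x0 + \<psi> x0 - Fstar" and A: "L * F0 + 3 / 8 * V \<le> 16 / 9 * A"
  shows "init_error_integrable \<Omega> f x0 (init_momentum \<gamma>i g0 g0)"
    and "0 < init_potential \<Omega> L Fstar f \<psi> x0 (init_momentum \<gamma>i g0 g0) \<Longrightarrow>
      \<exists>K. 1 \<le> K \<and> int K \<le> \<lceil>40000 * (A * \<sigma>\<^sup>2 / \<epsilon>\<^sup>2 + A / \<epsilon>)\<rceil> \<and>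
        reaches_accuracy \<Omega> D G f \<psi> L \<sigma> Fstar \<epsilon> x0 \<gamma>i g0 g0 K"
proof -
  note P = composite_problemD[OF prob]
  let ?\<Phi> = "init_potential \<Omega> L Fstar f \<psi> x0 (init_momentum \<gamma>i g0 g0)"
  show init: "init_error_integrable \<Omega> f x0 (init_momentum \<gamma>i g0 g0)"
    unfolding init_error_integrable_def init_momentum_gradient by (rule int)
  have "L * ?\<Phi> = L * F0 + 3 / 8 * (\<integral>\<omega>. (norm (g0 \<omega> - gradient f x0))\<^sup>2 \<partial>\<Omega>)"
    unfolding init_potential_def init_momentum_gradient F0 using P(1) by (simp add: field_simps)
  then have "22500 * (L * ?\<Phi>) \<le> 40000 * A" using var A by argo
  then show "\<exists>K. 1 \<le> K \<and> int K \<le> \<lceil>40000 * (A * \<sigma>\<^sup>2 / \<epsilon>\<^sup>2 + A / \<epsilon>)\<rceil> \<and>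
        reaches_accuracy \<Omega> D G f \<psi> L \<sigma> Fstar \<epsilon> x0 \<gamma>i g0 g0 K" if "0 < ?\<Phi>"
    by (rule iteration_count_reaches_accuracy[OF prob \<epsilon> \<Omega> meas meas init refl that])
qed

section \<open>The complexity theorem\<close>

theorem theorem1:
  shows "\<exists>C::real. 0 < C \<and> C \<le> C_max \<and>
    (\<forall>(L::real) (\<sigma>::real) (Fstar::real) (f :: real^'n \<Rightarrow> real) (\<psi> :: real^'n \<Rightarrow> real)
       (D :: 's measure) (G :: real^'n \<Rightarrow> 's \<Rightarrow> real^'n) (\<epsilon>::real) (x0 :: real^'n) (\<gamma>i::real)
       (\<Omega> :: 'w measure) (\<xi>0 :: 'w \<Rightarrow> 's) (mi :: 'w \<Rightarrow> real^'n).
       composite_problem L \<sigma> Fstar f \<psi> D G \<and> 0 < \<epsilon> \<and> \<gamma>i \<in> {0<..<1} \<and>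
       prob_space \<Omega> \<and> has_law \<Omega> D \<xi>0 \<and> mi \<in> borel_measurable \<Omega> \<longrightarrow>
       (let g0 = (\<lambda>\<omega>. G x0 (\<xi>0 \<omega>)); m0 = init_momentum \<gamma>i mi g0;
            \<Phi>0 = init_potential \<Omega> L Fstar f \<psi> x0 m0 in
        init_error_integrable \<Omega> f x0 m0 \<and> 0 < \<Phi>0 \<longrightarrow>
        (\<exists>K. 1 \<le> K \<and> int K \<le> \<lceil>C * (L * \<Phi>0 * \<sigma>\<^sup>2 / \<epsilon>\<^sup>2 + L * \<Phi>0 / \<epsilon>)\<rceil> \<and>
             reaches_accuracy \<Omega> D G f \<psi> L \<sigma> Fstar \<epsilon> x0 \<gamma>i mi g0 K)))
    \<and>
    (\<exists>h. init_rule h \<and>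
      (\<forall>(L::real) (\<sigma>::real) (Fstar::real) (f :: real^'n \<Rightarrow> real) (\<psi> :: real^'n \<Rightarrow> real)
         (D :: 's measure) (G :: real^'n \<Rightarrow> 's \<Rightarrow> real^'n) (\<epsilon>::real) (x0 :: real^'n) (\<gamma>i::real)
         (\<Omega> :: 'w measure) (\<xi>0 :: 'w \<Rightarrow> 's).
         composite_problem L \<sigma> Fstar f \<psi> D G \<and> (\<forall>x. \<psi> x = 0) \<and> 0 < \<epsilon> \<and> \<gamma>i \<in> {0<..<1} \<and>
         prob_space \<Omega> \<and> has_law \<Omega> D \<xi>0 \<longrightarrow>
         (let g0 = (\<lambda>\<omega>. G x0 (\<xi>0 \<omega>)); mi = (\<lambda>\<omega>. h \<gamma>i (g0 \<omega>)); m0 = init_momentum \<gamma>i mi g0;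
              F0 = f x0 + \<psi> x0 - Fstar in
          init_error_integrable \<Omega> f x0 m0 \<and>
          (0 < init_potential \<Omega> L Fstar f \<psi> x0 m0 \<longrightarrow>
           (\<exists>K. 1 \<le> K \<and> int K \<le> \<lceil>C * (L * F0 * \<sigma>\<^sup>2 / \<epsilon>\<^sup>2 + L * F0 / \<epsilon>)\<rceil> \<and>
                reaches_accuracy \<Omega> D G f \<psi> L \<sigma> Fstar \<epsilon> x0 \<gamma>i mi g0 K)))))
    \<and>
    (\<exists>h. init_rule h \<and>
      (\<forall>(L::real) (\<sigma>::real) (Fstar::real) (f :: real^'n \<Rightarrow> real) (\<psi> :: real^'n \<Rightarrow> real)
         (D :: 's measure) (G :: real^'n \<Rightarrow> 's \<Rightarrow> real^'n) (\<epsilon>::real) (x0 :: real^'n) (\<gamma>i::real)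
         (\<Omega> :: 'w measure) (\<xi>0 :: 'w \<Rightarrow> 's).
         composite_problem L \<sigma> Fstar f \<psi> D G \<and> 0 < \<epsilon> \<and> \<gamma>i \<in> {0<..<1} \<and>
         prob_space \<Omega> \<and> has_law \<Omega> D \<xi>0 \<longrightarrow>
         (let g0 = (\<lambda>\<omega>. G x0 (\<xi>0 \<omega>)); mi = (\<lambda>\<omega>. h \<gamma>i (g0 \<omega>)); m0 = init_momentum \<gamma>i mi g0;
              F0 = f x0 + \<psi> x0 - Fstar in
          init_error_integrable \<Omega> f x0 m0 \<and>
          (0 < init_potential \<Omega> L Fstar f \<psi> x0 m0 \<longrightarrow>
           (\<exists>K. 1 \<le> K \<and>
                int K \<le> \<lceil>C * (L * F0 * \<sigma>\<^sup>2 / \<epsilon>\<^sup>2 + \<sigma>^4 / \<epsilon>\<^sup>2 + L * F0 / \<epsilon> + \<sigma>\<^sup>2 / \<epsilon>)\<rceil> \<and>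
                reaches_accuracy \<Omega> D G f \<psi> L \<sigma> Fstar \<epsilon> x0 \<gamma>i mi g0 K)))))
    \<and>
    (\<exists>h. init_rule h \<and>
      (\<forall>(L::real) (\<sigma>::real) (Fstar::real) (f :: real^'n \<Rightarrow> real) (\<psi> :: real^'n \<Rightarrow> real)
         (D :: 's measure) (G :: real^'n \<Rightarrow> 's \<Rightarrow> real^'n) (\<epsilon>::real) (x0 :: real^'n) (\<gamma>i::real)
         (\<Omega> :: 'w measure) (\<zeta> :: nat \<Rightarrow> 'w \<Rightarrow> 's).
         let F0 = f x0 + \<psi> x0 - Fstar; b0 = batch_size L \<sigma> F0 in
         composite_problem L \<sigma> Fstar f \<psi> D G \<and> 0 < F0 \<and> 0 < \<epsilon> \<and> \<gamma>i \<in> {0<..<1} \<and>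
         prob_space \<Omega> \<and> (\<forall>i<b0. has_law \<Omega> D (\<zeta> i)) \<and>
         prob_space.indep_vars \<Omega> (\<lambda>_. D) \<zeta> {..<b0} \<longrightarrow>
         (let g0 = minibatch_gradient G x0 b0 \<zeta>; mi = (\<lambda>\<omega>. h \<gamma>i (g0 \<omega>));
              m0 = init_momentum \<gamma>i mi g0 in
          init_error_integrable \<Omega> f x0 m0 \<and>
          (\<exists>K. 1 \<le> K \<and> int K \<le> \<lceil>C * (L * F0 * \<sigma>\<^sup>2 / \<epsilon>\<^sup>2 + L * F0 / \<epsilon>)\<rceil> \<and>
               reaches_accuracy \<Omega> D G f \<psi> L \<sigma> Fstar \<epsilon> x0 \<gamma>i mi g0 K))))"
proof (rule exI[of _ "40000::real"], intro conjI)
  show "(0::real) < 40000" "(40000::real) \<le> C_max" by (simp_all add: C_max_def)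
next
  show "\<forall>(L::real) (\<sigma>::real) (Fstar::real) (f :: real^'n \<Rightarrow> real) (\<psi> :: real^'n \<Rightarrow> real)
       (D :: 's measure) (G :: real^'n \<Rightarrow> 's \<Rightarrow> real^'n) (\<epsilon>::real) (x0 :: real^'n) (\<gamma>i::real)
       (\<Omega> :: 'w measure) (\<xi>0 :: 'w \<Rightarrow> 's) (mi :: 'w \<Rightarrow> real^'n).
       composite_problem L \<sigma> Fstar f \<psi> D G \<and> 0 < \<epsilon> \<and> \<gamma>i \<in> {0<..<1} \<and>
       prob_space \<Omega> \<and> has_law \<Omega> D \<xi>0 \<and> mi \<in> borel_measurable \<Omega> \<longrightarrow>
       (let g0 = (\<lambda>\<omega>. G x0 (\<xi>0 \<omega>)); m0 = init_momentum \<gamma>i mi g0;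
            \<Phi>0 = init_potential \<Omega> L Fstar f \<psi> x0 m0 in
        init_error_integrable \<Omega> f x0 m0 \<and> 0 < \<Phi>0 \<longrightarrow>
        (\<exists>K. 1 \<le> K \<and> int K \<le> \<lceil>40000 * (L * \<Phi>0 * \<sigma>\<^sup>2 / \<epsilon>\<^sup>2 + L * \<Phi>0 / \<epsilon>)\<rceil> \<and>
             reaches_accuracy \<Omega> D G f \<psi> L \<sigma> Fstar \<epsilon> x0 \<gamma>i mi g0 K))"
  proof (unfold Let_def, intro allI impI, elim conjE)
    fix L \<sigma> Fstar \<epsilon> \<gamma>i :: real and f \<psi> :: "real^'n \<Rightarrow> real" and D :: "'s measure"
      and G :: "real^'n \<Rightarrow> 's \<Rightarrow> real^'n" and x0 :: "real^'n" and \<Omega> :: "'w measure"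
      and \<xi>0 :: "'w \<Rightarrow> 's" and mi :: "'w \<Rightarrow> real^'n"
    let ?g0 = "\<lambda>\<omega>. G x0 (\<xi>0 \<omega>)"
    let ?\<Phi> = "init_potential \<Omega> L Fstar f \<psi> x0 (init_momentum \<gamma>i mi ?g0)"
    assume prob: "composite_problem L \<sigma> Fstar f \<psi> D G" and \<epsilon>: "0 < \<epsilon>" and \<Omega>: "prob_space \<Omega>"
      and law: "has_law \<Omega> D \<xi>0" and mi: "mi \<in> borel_measurable \<Omega>"
      and init: "init_error_integrable \<Omega> f x0 (init_momentum \<gamma>i mi ?g0)" and \<Phi>: "0 < ?\<Phi>"
    show "\<exists>K. 1 \<le> K \<and> int K \<le> \<lceil>40000 * (L * ?\<Phi> * \<sigma>\<^sup>2 / \<epsilon>\<^sup>2 + L * ?\<Phi> / \<epsilon>)\<rceil> \<and>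
        reaches_accuracy \<Omega> D G f \<psi> L \<sigma> Fstar \<epsilon> x0 \<gamma>i mi ?g0 K"
    proof (rule iteration_count_reaches_accuracy[OF prob \<epsilon> \<Omega> mi sample_noise_moment(1)[OF prob law] init refl \<Phi>])
      have "0 \<le> L * ?\<Phi>" using composite_problemD(1)[OF prob] \<Phi> by simp
      then show "22500 * (L * ?\<Phi>) \<le> 40000 * (L * ?\<Phi>)" by linarith
    qed
  qed
next
  show "\<exists>h. init_rule h \<and>
      (\<forall>(L::real) (\<sigma>::real) (Fstar::real) (f :: real^'n \<Rightarrow> real) (\<psi> :: real^'n \<Rightarrow> real)
         (D :: 's measure) (G :: real^'n \<Rightarrow> 's \<Rightarrow> real^'n) (\<epsilon>::real) (x0 :: real^'n) (\<gamma>i::real)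
         (\<Omega> :: 'w measure) (\<xi>0 :: 'w \<Rightarrow> 's).
         composite_problem L \<sigma> Fstar f \<psi> D G \<and> (\<forall>x. \<psi> x = 0) \<and> 0 < \<epsilon> \<and> \<gamma>i \<in> {0<..<1} \<and>
         prob_space \<Omega> \<and> has_law \<Omega> D \<xi>0 \<longrightarrow>
         (let g0 = (\<lambda>\<omega>. G x0 (\<xi>0 \<omega>)); mi = (\<lambda>\<omega>. h \<gamma>i (g0 \<omega>)); m0 = init_momentum \<gamma>i mi g0;
              F0 = f x0 + \<psi> x0 - Fstar in
          init_error_integrable \<Omega> f x0 m0 \<and>
          (0 < init_potential \<Omega> L Fstar f \<psi> x0 m0 \<longrightarrow>
           (\<exists>K. 1 \<le> K \<and> int K \<le> \<lceil>40000 * (L * F0 * \<sigma>\<^sup>2 / \<epsilon>\<^sup>2 + L * F0 / \<epsilon>)\<rceil> \<and>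
                reaches_accuracy \<Omega> D G f \<psi> L \<sigma> Fstar \<epsilon> x0 \<gamma>i mi g0 K))))"
  \<comment> \<open>This rule makes the first momentum vanish.\<close>
  proof (rule exI[of _ "\<lambda>\<gamma>i g. (- \<gamma>i / (1 - \<gamma>i)) *\<^sub>R g"], unfold Let_def, intro conjI[of "init_rule _"] allI impI, goal_cases)
    case 1
    show ?case unfolding init_rule_def by measurable
  next
    case (2 L \<sigma> Fstar f \<psi> D G \<epsilon> x0 \<gamma>i \<Omega> \<xi>0)
    then have prob: "composite_problem L \<sigma> Fstar f \<psi> D G" and \<psi>: "\<And>x. \<psi> x = 0" and \<epsilon>: "0 < \<epsilon>"
      and \<Omega>: "prob_space \<Omega>" and law: "has_law \<Omega> D \<xi>0" and \<gamma>i: "\<gamma>i \<noteq> 1" by auto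
    have g0[measurable]: "(\<lambda>\<omega>. G x0 (\<xi>0 \<omega>)) \<in> borel_measurable \<Omega>"
      by (rule sample_noise_moment(1)[OF prob law])
    have mi: "(\<lambda>\<omega>. (- \<gamma>i / (1 - \<gamma>i)) *\<^sub>R G x0 (\<xi>0 \<omega>)) \<in> borel_measurable \<Omega>" by measurable
    show ?case
      using zero_init_complexity[OF prob \<psi> \<epsilon> \<Omega> mi g0 init_momentum_zero[OF \<gamma>i] refl] by blast
  qed
next
  show "\<exists>h. init_rule h \<and>
      (\<forall>(L::real) (\<sigma>::real) (Fstar::real) (f :: real^'n \<Rightarrow> real) (\<psi> :: real^'n \<Rightarrow> real)
         (D :: 's measure) (G :: real^'n \<Rightarrow> 's \<Rightarrow> real^'n) (\<epsilon>::real) (x0 :: real^'n) (\<gamma>i::real)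
         (\<Omega> :: 'w measure) (\<xi>0 :: 'w \<Rightarrow> 's).
         composite_problem L \<sigma> Fstar f \<psi> D G \<and> 0 < \<epsilon> \<and> \<gamma>i \<in> {0<..<1} \<and>
         prob_space \<Omega> \<and> has_law \<Omega> D \<xi>0 \<longrightarrow>
         (let g0 = (\<lambda>\<omega>. G x0 (\<xi>0 \<omega>)); mi = (\<lambda>\<omega>. h \<gamma>i (g0 \<omega>)); m0 = init_momentum \<gamma>i mi g0;
              F0 = f x0 + \<psi> x0 - Fstar in
          init_error_integrable \<Omega> f x0 m0 \<and>
          (0 < init_potential \<Omega> L Fstar f \<psi> x0 m0 \<longrightarrow>
           (\<exists>K. 1 \<le> K \<and>
                int K \<le> \<lceil>40000 * (L * F0 * \<sigma>\<^sup>2 / \<epsilon>\<^sup>2 + \<sigma>^4 / \<epsilon>\<^sup>2 + L * F0 / \<epsilon> + \<sigma>\<^sup>2 / \<epsilon>)\<rceil> \<and>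
                reaches_accuracy \<Omega> D G f \<psi> L \<sigma> Fstar \<epsilon> x0 \<gamma>i mi g0 K))))"
  proof (rule exI[of _ "\<lambda>_ g. g"], unfold Let_def, intro conjI[of "init_rule _"] allI impI, goal_cases)
    case 1
    show ?case unfolding init_rule_def by simp
  next
    case (2 L \<sigma> Fstar f \<psi> D G \<epsilon> x0 \<gamma>i \<Omega> \<xi>0)
    then have prob: "composite_problem L \<sigma> Fstar f \<psi> D G" and \<epsilon>: "0 < \<epsilon>"
      and \<Omega>: "prob_space \<Omega>" and law: "has_law \<Omega> D \<xi>0" by auto
    let ?F0 = "f x0 + \<psi> x0 - Fstar"
    note S = sample_noise_moment[OF prob law, of x0]
    have "0 \<le> L * ?F0" using composite_problemD(1,5)[OF prob] by simp
    then have A: "L * ?F0 + 3 / 8 * \<sigma>\<^sup>2 \<le> 16 / 9 * (L * ?F0 + \<sigma>\<^sup>2)"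
      using zero_le_power2[of \<sigma>] by argo
    have eq: "L * ?F0 * \<sigma>\<^sup>2 / \<epsilon>\<^sup>2 + \<sigma>^4 / \<epsilon>\<^sup>2 + L * ?F0 / \<epsilon> + \<sigma>\<^sup>2 / \<epsilon>
        = (L * ?F0 + \<sigma>\<^sup>2) * \<sigma>\<^sup>2 / \<epsilon>\<^sup>2 + (L * ?F0 + \<sigma>\<^sup>2) / \<epsilon>"
      by (simp add: distrib_right add_divide_distrib power2_eq_square power4_eq_xxxx)
    show ?case
      unfolding eq using gradient_init_complexity[OF prob \<epsilon> \<Omega> S(1-3) refl A] by blast
  qed
next
  show "\<exists>h. init_rule h \<and>
      (\<forall>(L::real) (\<sigma>::real) (Fstar::real) (f :: real^'n \<Rightarrow> real) (\<psi> :: real^'n \<Rightarrow> real)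
         (D :: 's measure) (G :: real^'n \<Rightarrow> 's \<Rightarrow> real^'n) (\<epsilon>::real) (x0 :: real^'n) (\<gamma>i::real)
         (\<Omega> :: 'w measure) (\<zeta> :: nat \<Rightarrow> 'w \<Rightarrow> 's).
         let F0 = f x0 + \<psi> x0 - Fstar; b0 = batch_size L \<sigma> F0 in
         composite_problem L \<sigma> Fstar f \<psi> D G \<and> 0 < F0 \<and> 0 < \<epsilon> \<and> \<gamma>i \<in> {0<..<1} \<and>
         prob_space \<Omega> \<and> (\<forall>i<b0. has_law \<Omega> D (\<zeta> i)) \<and>
         prob_space.indep_vars \<Omega> (\<lambda>_. D) \<zeta> {..<b0} \<longrightarrow>
         (let g0 = minibatch_gradient G x0 b0 \<zeta>; mi = (\<lambda>\<omega>. h \<gamma>i (g0 \<omega>));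
              m0 = init_momentum \<gamma>i mi g0 in
          init_error_integrable \<Omega> f x0 m0 \<and>
          (\<exists>K. 1 \<le> K \<and> int K \<le> \<lceil>40000 * (L * F0 * \<sigma>\<^sup>2 / \<epsilon>\<^sup>2 + L * F0 / \<epsilon>)\<rceil> \<and>
               reaches_accuracy \<Omega> D G f \<psi> L \<sigma> Fstar \<epsilon> x0 \<gamma>i mi g0 K)))"
  proof (rule exI[of _ "\<lambda>_ g. g"], unfold Let_def, intro conjI[of "init_rule _"] allI impI, goal_cases)
    case 1
    show ?case unfolding init_rule_def by simp
  next
    case (2 L \<sigma> Fstar f \<psi> D G \<epsilon> x0 \<gamma>i \<Omega> \<zeta>)
    let ?F0 = "f x0 + \<psi> x0 - Fstar"
    let ?b = "batch_size L \<sigma> ?F0"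
    from 2 have prob: "composite_problem L \<sigma> Fstar f \<psi> D G" and F0: "0 < ?F0" and \<epsilon>: "0 < \<epsilon>"
      and \<Omega>: "prob_space \<Omega>" and law: "\<forall>i<?b. has_law \<Omega> D (\<zeta> i)"
      and ind: "prob_space.indep_vars \<Omega> (\<lambda>_. D) \<zeta> {..<?b}" by auto
    have L: "0 < L" by (rule composite_problemD(1)[OF prob])
    have b: "0 < ?b" "\<sigma>\<^sup>2 / (L * ?F0) \<le> real ?b"
      using real_nat_ceiling_ge[of "\<sigma>\<^sup>2 / (L * ?F0)"] by (auto simp: batch_size_def)
    note B = minibatch_noise_moment[OF prob \<Omega> b(1) law ind, of x0]
    have "\<sigma>\<^sup>2 / real ?b \<le> L * ?F0" using b L F0 by (simp add: divide_le_eq mult.commute)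
    moreover have "0 < L * ?F0" using L F0 by (rule mult_pos_pos)
    ultimately have A: "L * ?F0 + 3 / 8 * (\<sigma>\<^sup>2 / real ?b) \<le> 16 / 9 * (L * ?F0)" by argo
    note gradient_init = gradient_init_complexity[OF prob \<epsilon> \<Omega> B refl A, of \<gamma>i]
    have "0 < init_potential \<Omega> L Fstar f \<psi> x0
        (init_momentum \<gamma>i (minibatch_gradient G x0 ?b \<zeta>) (minibatch_gradient G x0 ?b \<zeta>))"
      unfolding init_potential_def using L F0 by (intro add_pos_nonneg) auto
    from gradient_init(1) gradient_init(2)[OF this] show ?case by blast
  qed
qed

end
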